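(* Let $D=C_n^S$ be a cycle digraph on $n$ vertices such that $P_{C_n^S}$ is reflexive. Then $P_{C_n^S}$ possesses the integer decomposition property if and only if $D$ satisfies one of the following conditions: 1. $S=\varnothing$, or 2. $D$ is, up to a relabeling of the vertices (i.e. up to isomorphism of digraphs), one of the four cycle digraphs $$C_3^{\{1\}},\quad C_3^{\{1,2\}},\quad C_3^{\{1,2,3\}},\quad C_4^{\{1,3\}}.$$
   Context: For $n\ge 3$ and $S\subseteq[n]=\{1,\ldots,n\}$, the cycle digraph $C_n^S$ is the simple digraph on the vertex set $[n]$ whose set of directed edges $(\text{tail},\text{head})$ is $\overrightarrow{E}\cup\overleftarrow{E}$, where $$\overrightarrow{E}=\{(1,2),(2,3),\ldots,(n-1,n),(n,1)\},\qquad \overleftarrow{E}=\{(i,i-1): i\in S\},$$ with the convention that $(1,0)$ means $(1,n)$. For a digraph $D$ on $[n]$ let $a_{i,j}$ be the number of directed edges from $i$ (tail) to $j$ (head), and $\mathrm{outdeg}(i)=\sum_j a_{i,j}$. The Laplacian matrix of $D$ is $L(D)=O(D)-A(D)$, where $A(D)=(a_{i,j})$ and $O(D)$ is the diagonal matrix with entries $\mathrm{outdeg}(i)$. The Laplacian polytope of $D$ is $P_D=\operatorname{conv}\{\mathbf{v}_1,\ldots,\mathbf{v}_n\}\subset\mathbb{R}^n$, where $\mathbf{v}_i$ is the $i$-th row of $L(D)$. It lies in the hyperplane $H=\{\mathbf{x}\in\mathbb{R}^n:\sum_i x_i=0\}$ and is regarded as a lattice polytope with respect to $H\cap\mathbb{Z}^n$;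 deleting any one column of $L(D)$ and taking the convex hull of the rows gives a unimodularly equivalent copy of $P_D$ in $\mathbb{R}^{n-1}$ with lattice $\mathbb{Z}^{n-1}$. A full-dimensional lattice polytope $P\subset\mathbb{R}^d$ containing the origin in its interior is reflexive if its dual $P^*=\{\mathbf{x}\in\mathbb{R}^d:\mathbf{x}\cdot\mathbf{y}\le 1\text{ for all }\mathbf{y}\in P\}$ is again a lattice polytope (vertices in $\mathbb{Z}^d$). Every lattice polytope unimodularly equivalent (via an affine isomorphism of lattices) to such a $P$ is also called reflexive. A lattice polytope $P\subset\mathbb{R}^d$ has the integer decomposition property if for every positive integer $m$ and every $\mathbf{x}\in mP\cap\mathbb{Z}^d$ there exist $\mathbf{x}_1,\ldots,\mathbf{x}_m\in P\cap\mathbb{Z}^d$ with $\mathbf{x}=\mathbf{x}_1+\cdots+\mathbf{x}_m$. *)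

theory Defs
  imports
    "HOL-Analysis.Analysis"
    "HOL-Library.Function_Algebras"
    "Graph_Theory.Graph_Theory"
begin

text \<open>
  The dimension of a polytope varies within the statement (it is \<open>n\<close> or \<open>n - 1\<close>, and the
  definition of reflexivity quantifies over it), so \<open>\<real>\<^sup>n\<close> is taken to be
  \<^term>\<open>topspace (Euclidean_space n)\<close>, i.e. the functions of type \<^typ>\<open>nat \<Rightarrow> real\<close> that vanish
  outside \<open>{..<n}\<close>. The pointwise vector space structure on functions makes the library notions
  \<^term>\<open>convex hull V\<close> and \<^term>\<open>affine hull V\<close> available there.
\<close>

instantiation "fun" :: (type, real_vector) real_vector
begin

definition scaleR_fun :: "real \<Rightarrow> ('a \<Rightarrow> 'b) \<Rightarrow> 'a \<Rightarrow> 'b" where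
  "scaleR_fun c f = (\<lambda>x. c *\<^sub>R f x)"

instance
  by standard (simp_all add: scaleR_fun_def fun_eq_iff scaleR_add_right scaleR_add_left)

end

definition int_points :: "nat \<Rightarrow> (nat \<Rightarrow> real) set" where
  "int_points d = {x \<in> topspace (Euclidean_space d). \<forall>i. x i \<in> \<int>}"

text \<open>Throughout, \<open>\<Lambda>\<close> is the set of lattice points with respect to which a polytope is considered.\<close>

definition lattice_polytope :: "(nat \<Rightarrow> real) set \<Rightarrow> (nat \<Rightarrow> real) set \<Rightarrow> bool" where
  "lattice_polytope \<Lambda> P \<longleftrightarrow> (\<exists>V. finite V \<and> V \<subseteq> \<Lambda> \<and> P = convex hull V)"

definition dual_polytope :: "nat \<Rightarrow> (nat \<Rightarrow> real) set \<Rightarrow> (nat \<Rightarrow> real) set" where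
  "dual_polytope d P =
     {x \<in> topspace (Euclidean_space d). \<forall>y\<in>P. (\<Sum>i<d. x i * y i) \<le> 1}"

text \<open>Reflexivity of a full-dimensional polytope in \<open>\<real>\<^sup>d\<close> whose dual is taken at the origin.\<close>

definition centered_reflexive :: "nat \<Rightarrow> (nat \<Rightarrow> real) set \<Rightarrow> bool" where
  "centered_reflexive d Q \<longleftrightarrow>
     lattice_polytope (int_points d) Q \<and>
     affine hull Q = topspace (Euclidean_space d) \<and>
     0 \<in> Euclidean_space d interior_of Q \<and>
     lattice_polytope (int_points d) (dual_polytope d Q)"

definition affine_map_on :: "(nat \<Rightarrow> real) set \<Rightarrow> ((nat \<Rightarrow> real) \<Rightarrow> (nat \<Rightarrow> real)) \<Rightarrow> bool" where
  "affine_map_on A f \<longleftrightarrow>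
     (\<forall>x\<in>A. \<forall>y\<in>A. \<forall>u v. u + v = 1 \<longrightarrow> f (u *\<^sub>R x + v *\<^sub>R y) = u *\<^sub>R f x + v *\<^sub>R f y)"

text \<open>
  \<open>P\<close> lies in the affine subspace \<open>A\<close> of \<open>\<real>\<^sup>n\<close> with lattice \<open>A \<inter> \<int>\<^sup>n\<close>, and \<open>Q\<close> lies in the affine
  subspace \<open>B\<close> of \<open>\<real>\<^sup>d\<close> with lattice \<open>B \<inter> \<int>\<^sup>d\<close>.
\<close>

definition unimodularly_equivalent ::
  "nat \<Rightarrow> (nat \<Rightarrow> real) set \<Rightarrow> (nat \<Rightarrow> real) set \<Rightarrow>
   nat \<Rightarrow> (nat \<Rightarrow> real) set \<Rightarrow> (nat \<Rightarrow> real) set \<Rightarrow> bool" where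
  "unimodularly_equivalent n A P d B Q \<longleftrightarrow>
     (\<exists>f. affine_map_on A f \<and> bij_betw f A B \<and>
          f ` (A \<inter> int_points n) = B \<inter> int_points d \<and> f ` P = Q)"

definition reflexive_polytope ::
  "nat \<Rightarrow> (nat \<Rightarrow> real) set \<Rightarrow> (nat \<Rightarrow> real) set \<Rightarrow> bool" where
  "reflexive_polytope n A P \<longleftrightarrow>
     lattice_polytope (A \<inter> int_points n) P \<and>
     (\<exists>d Q. centered_reflexive d Q \<and>
            unimodularly_equivalent n A P d (topspace (Euclidean_space d)) Q)"

definition integer_decomposition_property ::
  "(nat \<Rightarrow> real) set \<Rightarrow> (nat \<Rightarrow> real) set \<Rightarrow> bool" where
  "integer_decomposition_property \<Lambda> P \<longleftrightarrow>
     (\<forall>m::nat. 0 < m \<longrightarrow>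
        (\<forall>x \<in> (\<lambda>p. real m *\<^sub>R p) ` P \<inter> \<Lambda>.
           \<exists>y. (\<forall>k<m. y k \<in> P \<inter> \<Lambda>) \<and> x = (\<Sum>k<m. y k)))"

definition num_arcs :: "(nat, 'b) pre_digraph \<Rightarrow> nat \<Rightarrow> nat \<Rightarrow> nat" where
  "num_arcs D i j = card {e \<in> arcs D. tail D e = i \<and> head D e = j}"

definition laplacian :: "(nat, 'b) pre_digraph \<Rightarrow> nat \<Rightarrow> nat \<Rightarrow> real" where
  "laplacian D i j = (if i = j then real (out_degree D i) else 0) - real (num_arcs D i j)"

text \<open>
  Vertices are numbered from 1 whereas coordinates of \<^term>\<open>Euclidean_space n\<close> are numbered from 0,
  so coordinate \<open>k\<close> of a row belongs to the vertex \<open>Suc k\<close>.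
\<close>

definition laplacian_row :: "nat \<Rightarrow> (nat, 'b) pre_digraph \<Rightarrow> nat \<Rightarrow> nat \<Rightarrow> real" where
  "laplacian_row n D i = (\<lambda>k. if k < n then laplacian D i (Suc k) else 0)"

definition laplacian_polytope :: "nat \<Rightarrow> (nat, 'b) pre_digraph \<Rightarrow> (nat \<Rightarrow> real) set" where
  "laplacian_polytope n D = convex hull (laplacian_row n D ` {1..n})"

definition sum_zero_hyperplane :: "nat \<Rightarrow> (nat \<Rightarrow> real) set" where
  "sum_zero_hyperplane n = {x \<in> topspace (Euclidean_space n). (\<Sum>i<n. x i) = 0}"

definition cycle_digraph :: "nat \<Rightarrow> nat set \<Rightarrow> nat pair_pre_digraph" where
  "cycle_digraph n S =
     \<lparr> pverts = {1..n},
       parcs = {(i, i + 1) | i. i \<in> {1..<n}} \<union> {(n, 1)} \<union>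
               {(i, if i = 1 then n else i - 1) | i. i \<in> S} \<rparr>"

end

theory Submission
  imports Defs
begin

text \<open>
  Let \<open>v\<^sub>1, \<dots>, v\<^sub>n\<close> be the rows of the Laplacian. For \<open>S \<noteq> {1..n}\<close> they generate the lattice, and their
  relations are the multiples of \<open>\<Sum>w\<^sub>i v\<^sub>i = 0\<close>, where \<open>w\<^sub>i\<close> is one more than the length of the run of
  elements of \<open>S\<close> that follows \<open>i\<close>. Put \<open>N = \<Sum>w\<^sub>i\<close>. The facet opposite to \<open>v\<^sub>i\<close> shows that reflexivity
  forces \<open>w\<^sub>i dvd N\<close>.

  Let \<open>M\<close> be the largest weight and \<open>\<mu>\<close> its multiplicity. The point
  \<open>\<Sum>(w\<^sub>i / M) v\<^sub>i - (\<Sum>{v\<^sub>i | w\<^sub>i = M})\<close> is a lattice point of \<open>(N / M - \<mu>) P\<close> that cannot be decomposed,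
  so the integer decomposition property implies \<open>N = M (\<mu> + 1)\<close>. A vertex of weight \<open>k + 1\<close> is followed
  by one of weight \<open>k\<close>, so each of the weights \<open>1, \<dots>, M\<close> occurs at least \<open>\<mu>\<close> times. Hence
  \<open>2 M (\<mu> + 1) \<ge> \<mu> M (M + 1)\<close>, that is \<open>\<mu> (M - 1) \<le> 2\<close>, which leaves three cases with \<open>n \<le> 4\<close>.

  Conversely, in the listed cases a lattice point of \<open>mP\<close> with \<open>m \<ge> 2\<close> stays in \<open>(m - 1) P\<close> after
  subtracting a vertex or the origin.
\<close>

section \<open>Combinations of the rows of the Laplacian\<close>

lemma sum_fun_eval: "(\<Sum>i\<in>A. f i) x = (\<Sum>i\<in>A. f i x :: real)" for f :: "'i \<Rightarrow> 'a \<Rightarrow> real"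
  by (induction A rule: infinite_finite_induct) auto

lemma scaleR_fun_eval [simp]: "(c *\<^sub>R f) x = c *\<^sub>R f x"
  by (simp add: scaleR_fun_def)

locale cycle_laplacian =
  fixes n :: nat and S :: "nat set"
  assumes n_ge_3: "3 \<le> n" and S_subset: "S \<subseteq> {1..n}"
begin

definition next_vertex :: "nat \<Rightarrow> nat" ("\<sigma>") where
  "\<sigma> i = Suc (i mod n)"

definition row :: "nat \<Rightarrow> nat \<Rightarrow> real" where
  "row i = laplacian_row n (with_proj (cycle_digraph n S)) i"

definition comb :: "(nat \<Rightarrow> real) \<Rightarrow> nat \<Rightarrow> real" where
  "comb l = (\<Sum>i\<in>{1..n}. l i *\<^sub>R row i)"

text \<open>If every vertex \<open>i\<close> sends the amount \<open>l i\<close> along each arc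
  leaving it, this is the net amount that crosses from \<open>i\<close> to
  \<open>\<sigma> i\<close>: the forward arc always exists, the backward one only if its tail
  \<open>\<sigma> i\<close> lies in \<open>S\<close>.\<close>

definition flow :: "(nat \<Rightarrow> real) \<Rightarrow> nat \<Rightarrow> real" where
  "flow l i = l i - of_bool (\<sigma> i \<in> S) * l (\<sigma> i)"

abbreviation \<Lambda> :: "(nat \<Rightarrow> real) set" where
  "\<Lambda> \<equiv> sum_zero_hyperplane n \<inter> int_points n"

abbreviation P :: "(nat \<Rightarrow> real) set" where
  "P \<equiv> laplacian_polytope n (with_proj (cycle_digraph n S))"

section \<open>The successor map on the cycle\<close>

lemma next_vertex_eq: "i \<in> {1..n} \<Longrightarrow> \<sigma> i = (if i = n then 1 else Suc i)"
  by (auto simp: next_vertex_def)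

lemma next_vertex_in: "\<sigma> i \<in> {1..n}"
  using n_ge_3 by (auto simp: next_vertex_def Suc_le_eq)

lemma inj_on_next_vertex: "inj_on \<sigma> {1..n}"
  by (auto simp: inj_on_def next_vertex_eq split: if_splits)

lemma next_vertex_eq_iff: "i \<in> {1..n} \<Longrightarrow> j \<in> {1..n} \<Longrightarrow> \<sigma> i = \<sigma> j \<longleftrightarrow> i = j"
  using inj_on_next_vertex by (rule inj_on_eq_iff)

lemma next_vertex_image: "\<sigma> ` {1..n} = {1..n}"
  using endo_inj_surj [OF _ _ inj_on_next_vertex] next_vertex_in by blast

lemma prev_vertexE:
  assumes "i \<in> {1..n}"
  obtains p where "p \<in> {1..n}" "i = \<sigma> p"
  using assms next_vertex_image by blast

lemma bij_next_vertex: "bij_betw \<sigma> {1..n} {1..n}"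
  using inj_on_next_vertex next_vertex_image unfolding bij_betw_def by blast

lemma next_vertex_neq:
  assumes "i \<in> {1..n}"
  shows "\<sigma> i \<noteq> i" "\<sigma> (\<sigma> i) \<noteq> i"
  using assms n_ge_3 by (auto simp: next_vertex_eq split: if_splits)

lemma next_vertex_induct [consumes 2, case_names base step]:
  assumes "i \<in> {1..n}" "j \<in> {1..n}" "Q i" "\<And>k. k \<in> {1..n} \<Longrightarrow> Q k \<Longrightarrow> Q (\<sigma> k)"
  shows "Q j"
proof -
  have "Q (Suc ((i - 1 + t) mod n))" for t
  proof (induction t)
    case 0
    have "Suc ((i - 1) mod n) = i" using assms(1) by (cases i) auto
    then show ?case using assms(3) by simp
  next
    case (Suc t)
    have "Suc ((i - 1 + t) mod n) \<in> {1..n}"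
      using n_ge_3 by (simp add: Suc_le_eq)
    from assms(4) [OF this Suc] show ?case
      by (simp add: next_vertex_def mod_Suc_eq)
  qed
  \<comment> \<open>The extra \<open>n\<close> steps keep the subtraction from being truncated when
    \<open>j < i\<close>; they vanish modulo \<open>n\<close>.\<close>
  moreover have "(i - 1 + (n + j - i)) mod n = j - 1"
  proof -
    have "i - 1 + (n + j - i) = n + (j - 1)" using assms(1,2) by auto
    moreover have "(j - 1) mod n = j - 1" using assms(2) by auto
    ultimately show ?thesis by simp
  qed
  ultimately have "Q (Suc (j - 1))" by metis
  then show ?thesis using assms(2) by simp
qed

text \<open>A failure of \<open>Q\<close> at \<open>j\<close> would propagate forward along the
  cycle until it reaches \<open>i\<close>.\<close>

lemma prev_vertex_induct [consumes 2, case_names base step]: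
  assumes "i \<in> {1..n}" "j \<in> {1..n}" "Q i" "\<And>k. k \<in> {1..n} \<Longrightarrow> Q (\<sigma> k) \<Longrightarrow> Q k"
  shows "Q j"
proof (rule ccontr)
  assume "\<not> Q j"
  have "\<not> Q i"
    by (rule next_vertex_induct [OF assms(2,1), where Q = "\<lambda>k. \<not> Q k"])
      (use \<open>\<not> Q j\<close> assms(4) in blast)+
  with assms(3) show False by blast
qed

section \<open>Arcs of the cycle digraph and entries of the Laplacian\<close>

lemma parcs_cycle:
  "(i, j) \<in> parcs (cycle_digraph n S) \<longleftrightarrow>
     i \<in> {1..n} \<and> j = \<sigma> i \<or> i \<in> S \<and> j \<in> {1..n} \<and> i = \<sigma> j"
proof -
  have "(\<exists>k. i = k \<and> j = k + 1 \<and> k \<in> {1..<n}) \<or> (i = n \<and> j = 1) \<longleftrightarrow> i \<in> {1..n} \<and> j = \<sigma> i"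
    using n_ge_3 by (cases "i = n") (auto simp: next_vertex_eq)
  \<comment> \<open>Describing the head by \<open>i = \<sigma> j\<close> absorbs the convention that
    \<open>(1, 0)\<close> means \<open>(1, n)\<close>.\<close>
  moreover have "i \<in> S \<and> j = (if i = 1 then n else i - 1) \<longleftrightarrow> i \<in> S \<and> j \<in> {1..n} \<and> i = \<sigma> j"
  proof (rule conj_cong [OF refl])
    assume "i \<in> S"
    then have "1 \<le> i" "i \<le> n" using S_subset by auto
    then have "j = (if i = 1 then n else i - 1) \<longleftrightarrow>
        1 \<le> j \<and> j \<le> n \<and> i = (if j = n then 1 else Suc j)"
      using n_ge_3 by presburger
    moreover have "i = \<sigma> j \<longleftrightarrow> i = (if j = n then 1 else Suc j)" if "j \<in> {1..n}"
      using next_vertex_eq [OF that] by simp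
    ultimately show "j = (if i = 1 then n else i - 1) \<longleftrightarrow> j \<in> {1..n} \<and> i = \<sigma> j"
      unfolding atLeastAtMost_iff by blast
  qed
  moreover have "(i, j) \<in> parcs (cycle_digraph n S) \<longleftrightarrow>
      ((\<exists>k. i = k \<and> j = k + 1 \<and> k \<in> {1..<n}) \<or> (i = n \<and> j = 1)) \<or>
      i \<in> S \<and> j = (if i = 1 then n else i - 1)"
    unfolding cycle_digraph_def by auto
  ultimately show ?thesis by simp
qed

lemma num_arcs_cycle:
  "num_arcs (with_proj (cycle_digraph n S)) i j = of_bool ((i, j) \<in> parcs (cycle_digraph n S))"
proof -
  have "{e \<in> parcs (cycle_digraph n S). fst e = i \<and> snd e = j} =
          (if (i, j) \<in> parcs (cycle_digraph n S) then {(i, j)} else {})"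
    by auto
  then show ?thesis by (simp add: num_arcs_def)
qed

lemma out_degree_cycle:
  assumes "i \<in> {1..n}"
  shows "out_degree (with_proj (cycle_digraph n S)) i = 1 + of_bool (i \<in> S)"
proof -
  obtain p where p: "p \<in> {1..n}" "i = \<sigma> p"
    using assms by (rule prev_vertexE)
  have "out_arcs (with_proj (cycle_digraph n S)) i = {(i, \<sigma> i)} \<union> (if i \<in> S then {(i, p)} else {})"
    unfolding out_arcs_def using p assms
    by (auto simp: parcs_cycle next_vertex_eq_iff simp del: One_nat_def atLeastAtMost_iff)
  \<comment> \<open>Here \<open>3 \<le> n\<close> enters: the two arcs leaving \<open>i\<close> have
    distinct heads.\<close>
  moreover have "\<sigma> i \<noteq> p" using p next_vertex_neq by metis
  ultimately show ?thesis by (simp add: out_degree_def)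
qed

text \<open>Coordinate \<open>j mod n\<close> belongs to the vertex \<open>\<sigma> j\<close>, since coordinates are numbered from 0.\<close>

lemma row_apply:
  assumes "i \<in> {1..n}" "j \<in> {1..n}"
  shows "row i (j mod n) =
           of_bool (i = \<sigma> j) * (1 + of_bool (i \<in> S)) - of_bool (i = j)
           - of_bool (i \<in> S) * of_bool (i = \<sigma> (\<sigma> j))"
proof -
  have "j mod n < n" using n_ge_3 by simp
  then have "row i (j mod n) = laplacian (with_proj (cycle_digraph n S)) i (\<sigma> j)"
    by (simp add: row_def laplacian_row_def next_vertex_def)
  also have "\<dots> = (if i = \<sigma> j then 1 + of_bool (i \<in> S) else 0)
      - of_bool (i = j \<or> i \<in> S \<and> i = \<sigma> (\<sigma> j))"
    using assms next_vertex_in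
    by (simp add: laplacian_def num_arcs_cycle out_degree_cycle parcs_cycle next_vertex_eq_iff
        del: One_nat_def atLeastAtMost_iff) blast
  \<comment> \<open>The forward and the backward arc into \<open>\<sigma> j\<close> start at
    different vertices, so the indicator of the disjunction is a sum.\<close>
  also have "of_bool (i = j \<or> i \<in> S \<and> i = \<sigma> (\<sigma> j)) =
      of_bool (i = j) + of_bool (i \<in> S) * (of_bool (i = \<sigma> (\<sigma> j)) :: real)"
  proof (cases "i = j")
    case True
    then have "i \<noteq> \<sigma> (\<sigma> j)" using next_vertex_neq(2) [OF assms(2)] by metis
    with True show ?thesis by (simp only: simp_thms of_bool_eq)
  qed (simp add: of_bool_conj)
  finally show ?thesis by (simp add: of_bool_def)
qed

text \<open>The three terms of \<open>row_apply\<close> regroup into the net amount leaving the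
  vertex \<open>\<sigma> j\<close>: the flow across the edge after it minus the flow across the edge
  before it.\<close>

lemma comb_apply:
  assumes "j \<in> {1..n}"
  shows "comb l (j mod n) = flow l (\<sigma> j) - flow l j"
proof -
  have *: "(\<Sum>i\<in>{1..n}. l i * (of_bool (i = k) * f i)) = l k * f k" if "k \<in> {1..n}" for f k
  proof -
    have "(\<Sum>i\<in>{1..n}. l i * (of_bool (i = k) * f i)) = (\<Sum>i\<in>{1..n}. if i = k then l k * f k else 0)"
      by (rule sum.cong) auto
    then show ?thesis using that by simp
  qed
  have "comb l (j mod n) = (\<Sum>i\<in>{1..n}. l i * row i (j mod n))"
    by (simp add: comb_def sum_fun_eval)
  also have "\<dots> = (\<Sum>i\<in>{1..n}. l i * (of_bool (i = \<sigma> j) * (1 + of_bool (i \<in> S))))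
     - (\<Sum>i\<in>{1..n}. l i * (of_bool (i = j) * 1))
     - (\<Sum>i\<in>{1..n}. l i * (of_bool (i = \<sigma> (\<sigma> j)) * of_bool (i \<in> S)))"
    unfolding sum_subtractf [symmetric]
    by (rule sum.cong) (use assms in \<open>auto simp: row_apply algebra_simps\<close>)
  also have "\<dots> = flow l (\<sigma> j) - flow l j"
    using assms next_vertex_in by (subst (1 2 3) *) (auto simp: flow_def algebra_simps)
  finally show ?thesis .
qed

lemma row_outside: "k \<ge> n \<Longrightarrow> row i k = 0"
  by (simp add: row_def laplacian_row_def)

lemma comb_outside: "k \<ge> n \<Longrightarrow> comb l k = 0"
  by (simp add: comb_def sum_fun_eval row_outside)

lemma bij_mod: "bij_betw (\<lambda>j. j mod n) {1..n} {..<n}"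
proof -
  have "bij_betw (\<lambda>j. \<sigma> j - 1) {1..n} {..<n}"
  proof (rule bij_betw_trans [OF bij_next_vertex, unfolded comp_def])
    show "bij_betw (\<lambda>j. j - 1) {1..n} {..<n}"
      by (rule bij_betw_byWitness [where f' = Suc]) auto
  qed
  then show ?thesis by (simp add: next_vertex_def)
qed

lemma coord_cases:
  assumes "k < n"
  obtains j where "j \<in> {1..n}" "k = j mod n"
  using assms bij_mod by (metis bij_betw_imp_surj_on imageE lessThan_iff)

section \<open>Linearity of combinations and membership in the lattice\<close>

lemma comb_add: "comb (\<lambda>i. l i + l' i) = comb l + comb l'"
  by (simp add: comb_def scaleR_add_left sum.distrib)

lemma comb_diff: "comb (\<lambda>i. l i - l' i) = comb l - comb l'"
  by (simp add: comb_def scaleR_diff_left sum_subtractf)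

lemma comb_scale: "comb (\<lambda>i. t * l i) = t *\<^sub>R comb l"
  by (simp add: comb_def scaleR_sum_right)

lemma comb_sum: "comb (\<lambda>i. \<Sum>k\<in>A. l k i) = (\<Sum>k\<in>A. comb (l k))"
  unfolding comb_def by (subst sum.swap) (simp add: scaleR_sum_left)

lemma comb_unit:
  assumes "j \<in> {1..n}"
  shows "comb (\<lambda>i. of_bool (i = j)) = row j"
proof -
  have "comb (\<lambda>i. of_bool (i = j)) = (\<Sum>i\<in>{1..n}. if i = j then row j else 0)"
    unfolding comb_def by (rule sum.cong) auto
  then show ?thesis using assms by simp
qed

text \<open>The differences of consecutive flows telescope around the cycle.\<close>

lemma sum_comb_coords: "(\<Sum>k<n. comb l k) = 0"
proof -
  have "(\<Sum>k<n. comb l k) = (\<Sum>j\<in>{1..n}. flow l (\<sigma> j) - flow l j)"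
    using sum.reindex_bij_betw [OF bij_mod, of "comb l"] by (simp add: comb_apply)
  then show ?thesis
    using sum.reindex_bij_betw [OF bij_next_vertex, of "flow l"] by (simp add: sum_subtractf)
qed

lemma comb_in_hyperplane: "comb l \<in> sum_zero_hyperplane n"
  by (simp add: sum_zero_hyperplane_def topspace_Euclidean_space comb_outside sum_comb_coords)

lemma comb_in_lattice_iff:
  "comb l \<in> \<Lambda> \<longleftrightarrow> (\<forall>j\<in>{1..n}. flow l (\<sigma> j) - flow l j \<in> \<int>)"
proof -
  have "comb l \<in> \<Lambda> \<longleftrightarrow> (\<forall>k. comb l k \<in> \<int>)"
    using comb_in_hyperplane [of l] by (auto simp: int_points_def sum_zero_hyperplane_def)
  also have "\<dots> \<longleftrightarrow> (\<forall>k<n. comb l k \<in> \<int>)"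
    using comb_outside by (metis Ints_0 not_le)
  also have "\<dots> \<longleftrightarrow> (\<forall>j\<in>{1..n}. comb l (j mod n) \<in> \<int>)"
    using n_ge_3 by (auto elim!: coord_cases)
  finally show ?thesis by (simp add: comb_apply)
qed

text \<open>Consecutive flows differ by a coordinate of the lattice point, which is an integer;
  walking around the cycle compares any two of them.\<close>

lemma flow_cong_int:
  assumes "comb l \<in> \<Lambda>" "i \<in> {1..n}" "j \<in> {1..n}"
  shows "flow l j - flow l i \<in> \<int>"
proof (use assms(2,3) in \<open>induction rule: next_vertex_induct\<close>)
  case (step k)
  then have "flow l (\<sigma> k) - flow l k \<in> \<int>" using assms(1) comb_in_lattice_iff by blast
  from Ints_add [OF this step(2)] show ?case by simp
qed simp

lemma flow_eq:
  assumes "comb l = 0" "i \<in> {1..n}" "j \<in> {1..n}"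
  shows "flow l j = flow l i"
proof (use assms(2,3) in \<open>induction rule: next_vertex_induct\<close>)
  case (step k)
  then show ?case using comb_apply [of k l] assms(1) by simp
qed simp

lemma comb_eq_0I:
  assumes "\<And>j. j \<in> {1..n} \<Longrightarrow> flow l j = K"
  shows "comb l = 0"
proof
  fix k show "comb l k = 0 k"
    using assms comb_outside [of k] next_vertex_in
    by (cases "k < n") (auto elim!: coord_cases simp: comb_apply)
qed

text \<open>All later arguments treat points of dilates through nonnegative coefficients of
  prescribed sum. For \<open>t = 1\<close> the set of such combinations is convex and contains the
  rows; scaling the coefficients gives the other dilates.\<close>

lemma scaled_polytope:
  assumes "0 < t"
  shows "(\<lambda>p. t *\<^sub>R p) ` P = {comb l | l. (\<forall>i\<in>{1..n}. 0 \<le> l i) \<and> (\<Sum>i\<in>{1..n}. l i) = t}"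
proof -
  define C where "C = {comb l | l. (\<forall>i\<in>{1..n}. 0 \<le> l i) \<and> (\<Sum>i\<in>{1..n}. l i) = 1}"
  have "P = C"
  proof
    have "convex C"
    proof (rule convexI)
      fix x y and u v :: real
      assume "x \<in> C" "y \<in> C" and uv: "0 \<le> u" "0 \<le> v" "u + v = 1"
      then obtain l l' where l: "x = comb l" "\<forall>i\<in>{1..n}. 0 \<le> l i" "(\<Sum>i\<in>{1..n}. l i) = 1"
        and l': "y = comb l'" "\<forall>i\<in>{1..n}. 0 \<le> l' i" "(\<Sum>i\<in>{1..n}. l' i) = 1"
        unfolding C_def by blast
      have "u *\<^sub>R x + v *\<^sub>R y = comb (\<lambda>i. u * l i + v * l' i)"
        using l l' by (simp add: comb_add comb_scale)
      moreover have "(\<Sum>i\<in>{1..n}. u * l i + v * l' i) = 1"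
        using l l' uv by (simp add: sum.distrib flip: sum_distrib_left)
      moreover have "\<forall>i\<in>{1..n}. 0 \<le> u * l i + v * l' i" using l l' uv by simp
      ultimately show "u *\<^sub>R x + v *\<^sub>R y \<in> C" unfolding C_def by blast
    qed
    moreover have "row ` {1..n} \<subseteq> C"
    proof clarify
      fix j assume "j \<in> {1..n}"
      then have "row j = comb (\<lambda>i. of_bool (i = j))"
        by (rule comb_unit [symmetric])
      moreover have "(\<Sum>i\<in>{1..n}. of_bool (i = j)) = (1::real)"
        using \<open>j \<in> {1..n}\<close> by (simp add: of_bool_def)
      moreover have "\<forall>i\<in>{1..n}. 0 \<le> (of_bool (i = j) :: real)" by simp
      ultimately show "row j \<in> C" unfolding C_def by blast
    qed
    ultimately show "P \<subseteq> C"
      unfolding laplacian_polytope_def row_def [symmetric] by (rule hull_minimal [rotated])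
  next
    show "C \<subseteq> P"
    proof
      fix x assume "x \<in> C"
      then obtain l where l: "x = comb l" "\<forall>i\<in>{1..n}. 0 \<le> l i" "(\<Sum>i\<in>{1..n}. l i) = 1"
        unfolding C_def by blast
      show "x \<in> P" unfolding l(1) comb_def
        by (rule convex_sum)
          (use l in \<open>auto simp: laplacian_polytope_def row_def convex_convex_hull intro: hull_inc\<close>)
    qed
  qed
  moreover have "(\<lambda>p. t *\<^sub>R p) ` C =
      {comb l | l. (\<forall>i\<in>{1..n}. 0 \<le> l i) \<and> (\<Sum>i\<in>{1..n}. l i) = t}" (is "_ = ?R")
  proof (intro equalityI subsetI)
    fix x assume "x \<in> (\<lambda>p. t *\<^sub>R p) ` C"
    then obtain l where l: "x = t *\<^sub>R comb l" "\<forall>i\<in>{1..n}. 0 \<le> l i" "(\<Sum>i\<in>{1..n}. l i) = 1"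
      unfolding C_def by blast
    then have "x = comb (\<lambda>i. t * l i)" "\<forall>i\<in>{1..n}. 0 \<le> t * l i" "(\<Sum>i\<in>{1..n}. t * l i) = t"
      using assms by (simp_all add: comb_scale flip: sum_distrib_left)
    then show "x \<in> ?R" by blast
  next
    fix x assume "x \<in> ?R"
    then obtain l where l: "x = comb l" "\<forall>i\<in>{1..n}. 0 \<le> l i" "(\<Sum>i\<in>{1..n}. l i) = t"
      by blast
    define l' where "l' = (\<lambda>i. (1 / t) * l i)"
    have "x = t *\<^sub>R comb l'" "\<forall>i\<in>{1..n}. 0 \<le> l' i" "(\<Sum>i\<in>{1..n}. l' i) = 1"
      unfolding l'_def comb_scale sum_distrib_left [symmetric] using assms l by simp_all
    then show "x \<in> (\<lambda>p. t *\<^sub>R p) ` C" unfolding C_def by blast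
  qed
  ultimately show ?thesis by simp
qed

lemma polytope_eq:
  "P = {comb l | l. (\<forall>i\<in>{1..n}. 0 \<le> l i) \<and> (\<Sum>i\<in>{1..n}. l i) = 1}"
  using scaled_polytope [of 1] by simp

section \<open>Relations between the rows\<close>

definition run_length :: "nat \<Rightarrow> nat" where
  "run_length i = (LEAST t. (\<sigma> ^^ t) i \<notin> S)"

text \<open>For \<open>S = {1..n}\<close> the runs are infinite and \<^const>\<open>run_length\<close> is meaningless.\<close>

definition weight :: "nat \<Rightarrow> nat" where
  "weight i = (if S = {1..n} then 1 else Suc (run_length (\<sigma> i)))"

definition total :: nat where
  "total = (\<Sum>i\<in>{1..n}. weight i)"

lemma run_length_rec:
  assumes "S \<noteq> {1..n}" "i \<in> {1..n}"
  shows "run_length i = (if i \<in> S then Suc (run_length (\<sigma> i)) else 0)"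
proof (cases "i \<in> S")
  case True
  obtain i0 where "i0 \<in> {1..n}" "i0 \<notin> S" using assms(1) S_subset by blast
  \<comment> \<open>Going backwards from a vertex \<open>i0\<close> outside \<open>S\<close> shows
    that the run starting at \<open>i\<close> ends, so that the \<open>LEAST\<close> in
    \<open>run_length\<close> is attained.\<close>
  then obtain t where "(\<sigma> ^^ t) i \<notin> S"
  proof (induction rule: prev_vertex_induct [OF \<open>i0 \<in> {1..n}\<close> assms(2)])
    case 1
    then show ?case by (metis funpow_0)
  next
    case (2 k)
    then show ?case by (metis funpow_Suc_right o_apply)
  qed
  from Least_Suc [where P = "\<lambda>t. (\<sigma> ^^ t) i \<notin> S", OF this] True show ?thesis
    by (simp add: run_length_def funpow_swap1)
next
  case False
  then show ?thesis by (simp add: run_length_def)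
qed

lemma weight_rec:
  assumes "S \<noteq> {1..n}"
  shows "weight i = (if \<sigma> i \<in> S then Suc (weight (\<sigma> i)) else 1)"
  using run_length_rec [OF assms next_vertex_in, of i] assms by (auto simp: weight_def)

lemma weight_pos: "0 < weight i"
  by (simp add: weight_def)

lemma weight_full: "S = {1..n} \<Longrightarrow> weight i = 1"
  unfolding weight_def by (rule if_P)

lemma flow_full:
  assumes "S = {1..n}"
  shows "flow l i = l i - l (\<sigma> i)"
proof -
  have "\<sigma> i \<in> S" unfolding assms by (rule next_vertex_in)
  then show ?thesis by (simp add: flow_def)
qed

text \<open>A combination vanishes when its flow is constant. For proper \<open>S\<close> the
  recursion \<open>weight_rec\<close> says exactly that the flow of the weights is 1 everywhere; for
  full \<open>S\<close> the weights are constant and their flow is 0.\<close>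

lemma flow_weight:
  "flow (\<lambda>i. real (weight i)) i = of_bool (S \<noteq> {1..n})"
proof (cases "S = {1..n}")
  case True
  then show ?thesis unfolding flow_full [OF True] weight_full [OF True] by simp
next
  case False
  then show ?thesis using weight_rec [OF False, of i] by (simp add: flow_def)
qed

lemma comb_weight: "comb (\<lambda>i. real (weight i)) = 0"
  by (rule comb_eq_0I) (rule flow_weight)

lemma total_pos: "0 < total"
  unfolding total_def using n_ge_3 weight_pos by (intro sum_pos) auto

lemma sum_weight: "(\<Sum>i\<in>{1..n}. real (weight i)) = real total"
  by (simp add: total_def)

text \<open>No backward arc enters such a vertex \<open>p\<close> from \<open>\<sigma> p\<close>, so
  \<open>flow l p\<close> is just \<open>l p\<close>. This starts the backward inductions around the
  cycle.\<close>

lemma ex_weight_1: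
  assumes "S \<noteq> {1..n}"
  obtains p where "p \<in> {1..n}" "\<sigma> p \<notin> S" "weight p = 1"
proof -
  obtain i where "i \<in> {1..n}" "i \<notin> S" using assms S_subset by blast
  then obtain p where "p \<in> {1..n}" "\<sigma> p \<notin> S" by (metis prev_vertexE)
  with that weight_rec [OF assms] show thesis by simp
qed

lemma flow_diff_weight:
  assumes "S \<noteq> {1..n}"
  shows "flow (\<lambda>i. l i - t * real (weight i)) i = flow l i - t"
proof -
  have "flow (\<lambda>i. l i - t * real (weight i)) i = flow l i - t * flow (\<lambda>i. real (weight i)) i"
    by (simp add: flow_def algebra_simps)
  then show ?thesis using flow_weight assms by simp
qed

text \<open>Subtracting the multiple \<open>flow l p\<close> of the relation makes the coefficient
  at \<open>p\<close> zero and all flows integral; the definition of \<open>flow\<close> then yields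
  integrality vertex by vertex, going backwards. As the weights give the zero combination, lattice
  points among the combinations are integral combinations of the rows.\<close>

lemma lattice_coefficients:
  assumes "S \<noteq> {1..n}" "comb l \<in> \<Lambda>"
  obtains t where "\<And>i. i \<in> {1..n} \<Longrightarrow> l i - t * real (weight i) \<in> \<int>"
proof -
  obtain p where p: "p \<in> {1..n}" "\<sigma> p \<notin> S" "weight p = 1" using ex_weight_1 [OF assms(1)] .
  define b where "b = (\<lambda>i. l i - flow l p * real (weight i))"
  have flow_b: "flow b i \<in> \<int>" if "i \<in> {1..n}" for i
    unfolding b_def flow_diff_weight [OF assms(1)]
    using flow_cong_int [OF assms(2) p(1) that] .
  have "b i \<in> \<int>" if "i \<in> {1..n}" for i
  proof (use p(1) that in \<open>induction rule: prev_vertex_induct\<close>)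
    case base
    then show ?case using p by (simp add: b_def flow_def)
  next
    case (step k)
    then have "flow b k + of_bool (\<sigma> k \<in> S) * b (\<sigma> k) \<in> \<int>"
      by (intro Ints_add Ints_mult flow_b) auto
    then show ?case by (simp add: flow_def)
  qed
  then show thesis by (intro that [of "flow l p"]) (simp add: b_def)
qed

text \<open>The relations between the rows form a line. For full \<open>S\<close> the flows are
  equal and sum to 0, so consecutive coefficients agree; for proper \<open>S\<close> the argument is
  that of \<open>lattice_coefficients\<close> with 0 in place of integers.\<close>

lemma kernel_coefficients:
  assumes "comb l = 0"
  obtains t where "\<And>i. i \<in> {1..n} \<Longrightarrow> l i = t * real (weight i)"
proof (cases "S = {1..n}")
  case True
  have one: "1 \<in> {1..n}" using n_ge_3 by simp
  note flow = flow_full [OF True]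
  have "(\<Sum>i\<in>{1..n}. flow l i) = 0"
    using sum.reindex_bij_betw [OF bij_next_vertex, of l] by (simp add: flow sum_subtractf)
  moreover have "(\<Sum>i\<in>{1..n}. flow l i) = (\<Sum>i\<in>{1..n}. flow l 1)"
    by (rule sum.cong [OF refl]) (rule flow_eq [OF assms one])
  ultimately have "flow l 1 = 0" using n_ge_3 by simp
  have "l i = l 1" if "i \<in> {1..n}" for i
  proof (use one that in \<open>induction rule: next_vertex_induct\<close>)
    case (step k)
    have "flow l k = 0" using flow_eq [OF assms one step(1)] \<open>flow l 1 = 0\<close> by simp
    with step(2) show ?case by (simp add: flow)
  qed simp
  then have "l i = l 1 * real (weight i)" if "i \<in> {1..n}" for i
    unfolding weight_full [OF True] using that by (metis mult.right_neutral of_nat_1)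
  then show thesis by (rule that)
next
  case False
  obtain p where p: "p \<in> {1..n}" "\<sigma> p \<notin> S" "weight p = 1" using ex_weight_1 [OF False] .
  define b where "b = (\<lambda>i. l i - flow l p * real (weight i))"
  have flow_b: "flow b i = 0" if "i \<in> {1..n}" for i
    unfolding b_def flow_diff_weight [OF False]
    using flow_eq [OF assms p(1) that] by simp
  have "b i = 0" if "i \<in> {1..n}" for i
  proof (use p(1) that in \<open>induction rule: prev_vertex_induct\<close>)
    case base
    then show ?case using p by (simp add: b_def flow_def)
  next
    case (step k)
    then show ?case using flow_b [OF step(1)] by (simp add: flow_def)
  qed
  then show thesis by (intro that [of "flow l p"]) (simp add: b_def)
qed

text \<open>The difference of the coefficients is a multiple of the weights whose sum is 0, while
  \<open>total\<close> is positive. Hence coefficients of sum 1 are barycentric coordinates.\<close>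

lemma comb_inj:
  assumes "comb l = comb l'" "(\<Sum>i\<in>{1..n}. l i) = (\<Sum>i\<in>{1..n}. l' i)" "i \<in> {1..n}"
  shows "l i = l' i"
proof -
  have "comb (\<lambda>i. l i - l' i) = 0" using assms(1) by (simp add: comb_diff)
  then obtain t where t: "\<And>i. i \<in> {1..n} \<Longrightarrow> l i - l' i = t * real (weight i)"
    using kernel_coefficients by blast
  have "0 = (\<Sum>i\<in>{1..n}. l i - l' i)" using assms(2) by (simp add: sum_subtractf)
  also have "\<dots> = t * real total"
    by (simp add: t sum_weight [symmetric] sum_distrib_left)
  finally have "t = 0" using total_pos by simp
  then show ?thesis using t [OF assms(3)] by simp
qed

section \<open>Lattice points of the polytope and its dilates\<close>

lemma lattice_diff: "x \<in> \<Lambda> \<Longrightarrow> y \<in> \<Lambda> \<Longrightarrow> x - y \<in> \<Lambda>"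
  by (auto simp: sum_zero_hyperplane_def int_points_def topspace_Euclidean_space sum_subtractf)

lemma comb_int_in_lattice:
  assumes "\<And>i. i \<in> {1..n} \<Longrightarrow> l i \<in> \<int>"
  shows "comb l \<in> \<Lambda>"
  unfolding comb_in_lattice_iff flow_def
  using assms next_vertex_in by (auto intro!: Ints_diff Ints_mult simp del: One_nat_def atLeastAtMost_iff)

lemma row_in_lattice: "j \<in> {1..n} \<Longrightarrow> row j \<in> \<Lambda>"
  using comb_int_in_lattice [of "\<lambda>i. of_bool (i = j)"] by (simp add: comb_unit del: One_nat_def atLeastAtMost_iff)

lemma zero_in_lattice: "0 \<in> \<Lambda>"
  by (simp add: sum_zero_hyperplane_def int_points_def topspace_Euclidean_space)

lemma in_polytopeI: "(\<And>i. i \<in> {1..n} \<Longrightarrow> 0 \<le> l i) \<Longrightarrow> (\<Sum>i\<in>{1..n}. l i) = 1 \<Longrightarrow> comb l \<in> P"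
  unfolding polytope_eq by blast

lemma sum_unit: "j \<in> {1..n} \<Longrightarrow> (\<Sum>i\<in>{1..n}. of_bool (i = j)) = (1 :: real)"
  by (simp add: of_bool_def)

lemma row_in_polytope: "j \<in> {1..n} \<Longrightarrow> row j \<in> P"
  using in_polytopeI [of "\<lambda>i. of_bool (i = j)"]
  by (simp add: comb_unit sum_unit del: One_nat_def atLeastAtMost_iff)

lemma zero_in_polytope: "0 \<in> P"
proof -
  have "comb (\<lambda>i. (1 / real total) * real (weight i)) \<in> P"
    using total_pos
    by (intro in_polytopeI) (simp_all only: sum_distrib_left [symmetric] sum_weight, simp_all)
  then show ?thesis unfolding comb_scale comb_weight by simp
qed

text \<open>A lattice point of \<open>mP\<close> is decomposed by splitting off a vertex or the origin.\<close>

lemma integer_decompositionI: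
  assumes "\<And>m l. 2 \<le> m \<Longrightarrow> (\<And>i. i \<in> {1..n} \<Longrightarrow> 0 \<le> l i) \<Longrightarrow> (\<And>i. i \<in> {1..n} \<Longrightarrow> l i < 1) \<Longrightarrow>
    (\<Sum>i\<in>{1..n}. l i) = real m \<Longrightarrow> comb l \<in> \<Lambda> \<Longrightarrow>
    (\<And>i. i \<in> {1..n} \<Longrightarrow> real (weight i) \<le> l i * real total)"
  shows "integer_decomposition_property \<Lambda> P"
proof -
  have decomp: "\<exists>y. (\<forall>k<m. y k \<in> P \<inter> \<Lambda>) \<and> comb l = (\<Sum>k<m. y k)"
    if "0 < m" "\<And>i. i \<in> {1..n} \<Longrightarrow> 0 \<le> l i" "(\<Sum>i\<in>{1..n}. l i) = real m" "comb l \<in> \<Lambda>" for m l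
    using that
  proof (induction m arbitrary: l rule: nat_induct_non_zero)
    case 1
    then have "comb l \<in> P" by (intro in_polytopeI) simp_all
    with 1 show ?case by (intro exI [of _ "\<lambda>_. comb l"]) simp
  next
    case (Suc m)
    obtain p l' where p: "p \<in> P \<inter> \<Lambda>" "comb l' = comb l - p"
      and l': "\<And>i. i \<in> {1..n} \<Longrightarrow> 0 \<le> l' i" "(\<Sum>i\<in>{1..n}. l' i) = real m"
    proof (cases "\<exists>j\<in>{1..n}. 1 \<le> l j")
      case True
      then obtain j where j: "j \<in> {1..n}" "1 \<le> l j" by blast
      show thesis
      proof (rule that [of "row j" "\<lambda>i. l i - of_bool (i = j)"])
        show "row j \<in> P \<inter> \<Lambda>" using j row_in_lattice row_in_polytope by blast
      qed (use j Suc.prems in \<open>auto simp: comb_diff comb_unit sum_subtractf sum_unit simp del: One_nat_def atLeastAtMost_iff\<close>)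
    next
      case False
      have w: "real (weight i) \<le> l i * real total" if "i \<in> {1..n}" for i
        using Suc.hyps Suc.prems False that
        by (intro assms [of "Suc m"]) (auto simp: not_le simp del: One_nat_def atLeastAtMost_iff)
      show thesis
      \<comment> \<open>The origin is split off by subtracting its barycentric coordinates, which
        leaves the point unchanged and lowers the coefficient sum by 1.\<close>
      proof (rule that [of 0 "\<lambda>i. l i - (1 / real total) * real (weight i)"])
        show "0 \<in> P \<inter> \<Lambda>" using zero_in_lattice zero_in_polytope by blast
        show "comb (\<lambda>i. l i - (1 / real total) * real (weight i)) = comb l - 0"
          unfolding comb_diff comb_scale comb_weight by simp
        show "0 \<le> l i - (1 / real total) * real (weight i)" if "i \<in> {1..n}" for i
          using w [OF that] total_pos by (simp add: field_simps)
        show "(\<Sum>i\<in>{1..n}. l i - (1 / real total) * real (weight i)) = real m"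
          unfolding sum_subtractf sum_distrib_left [symmetric] sum_weight
          using Suc.prems total_pos by simp
      qed
    qed
    have "comb l' \<in> \<Lambda>" using lattice_diff p Suc.prems(3) by fastforce
    from Suc.IH [OF l' this] obtain y where y: "\<forall>k<m. y k \<in> P \<inter> \<Lambda>" "comb l' = (\<Sum>k<m. y k)"
      by blast
    have "comb l = (\<Sum>k<Suc m. (y(m := p)) k)"
      using y p by (simp add: algebra_simps)
    moreover have "\<forall>k<Suc m. (y(m := p)) k \<in> P \<inter> \<Lambda>"
      using y p by (simp add: less_Suc_eq)
    ultimately show ?case by blast
  qed
  then show ?thesis
    unfolding integer_decomposition_property_def
  proof (intro allI impI ballI)
    fix m :: nat and x
    assume m: "0 < m" and x: "x \<in> (\<lambda>p. real m *\<^sub>R p) ` P \<inter> \<Lambda>"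
    have "0 < real m" using m by simp
    from x obtain l where "x = comb l" "\<forall>i\<in>{1..n}. 0 \<le> l i" "(\<Sum>i\<in>{1..n}. l i) = real m" "x \<in> \<Lambda>"
      unfolding scaled_polytope [OF \<open>0 < real m\<close>] by blast
    with decomp [OF m, of l] show "\<exists>y. (\<forall>k<m. y k \<in> P \<inter> \<Lambda>) \<and> x = (\<Sum>k<m. y k)" by blast
  qed
qed

end

section \<open>Reflexive simplices\<close>

definition dot :: "nat \<Rightarrow> (nat \<Rightarrow> real) \<Rightarrow> (nat \<Rightarrow> real) \<Rightarrow> real" where
  "dot d x y = (\<Sum>i<d. x i * y i)"

lemma dot_commute: "dot d x y = dot d y x"
  by (simp add: dot_def mult.commute)

lemma dot_add_right: "dot d x (y + z) = dot d x y + dot d x z"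
  by (simp add: dot_def distrib_left sum.distrib)

lemma dot_scale_right: "dot d x (c *\<^sub>R y) = c * dot d x y"
  by (simp add: dot_def sum_distrib_left mult.left_commute)

lemma dot_zero_right [simp]: "dot d x 0 = 0"
  by (simp add: dot_def)

lemma dot_sum_right: "dot d x (\<Sum>i\<in>A. f i) = (\<Sum>i\<in>A. dot d x (f i))"
  unfolding dot_def sum_fun_eval sum_distrib_left by (rule sum.swap)

lemma convex_halfspace: "convex {y. dot d x y \<le> c}"
proof (rule convexI)
  fix y z and u v :: real
  assume "y \<in> {y. dot d x y \<le> c}" "z \<in> {y. dot d x y \<le> c}" and uv: "0 \<le> u" "0 \<le> v" "u + v = 1"
  then have "u * dot d x y + v * dot d x z \<le> u * c + v * c"
    by (intro add_mono mult_left_mono) auto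
  then show "u *\<^sub>R y + v *\<^sub>R z \<in> {y. dot d x y \<le> c}"
    using uv by (simp add: dot_add_right dot_scale_right flip: distrib_right)
qed

lemma dot_le_convex_hull:
  assumes "\<And>y. y \<in> V \<Longrightarrow> dot d x y \<le> c" "y \<in> convex hull V"
  shows "dot d x y \<le> c"
  using hull_minimal [of V "{y. dot d x y \<le> c}" convex] convex_halfspace assms by blast

lemma dot_int_points:
  "x \<in> int_points d \<Longrightarrow> y \<in> int_points d \<Longrightarrow> dot d x y \<in> \<int>"
  by (auto simp: dot_def int_points_def intro!: Ints_sum Ints_mult)

lemma dual_polytope_iff:
  "x \<in> dual_polytope d Q \<longleftrightarrow> x \<in> topspace (Euclidean_space d) \<and> (\<forall>y\<in>Q. dot d x y \<le> 1)"
  by (simp add: dual_polytope_def dot_def)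

text \<open>A point supported on the first \<open>d\<close> coordinates is a finite combination of
  the unit vectors \<open>?e k\<close>, so the values of \<open>h\<close> there determine it on such
  points.\<close>

lemma linear_functional_dot:
  fixes h :: "(nat \<Rightarrow> real) \<Rightarrow> real"
  assumes "linear h"
  obtains u where "u \<in> topspace (Euclidean_space d)"
    "\<And>y. y \<in> topspace (Euclidean_space d) \<Longrightarrow> h y = dot d u y"
proof
  let ?e = "\<lambda>k i. of_bool (i = k) :: real"
  show "(\<lambda>k. if k < d then h (?e k) else 0) \<in> topspace (Euclidean_space d)"
    by (simp add: topspace_Euclidean_space)
  fix y assume "y \<in> topspace (Euclidean_space d)"
  have "y = (\<Sum>k<d. y k *\<^sub>R ?e k)"
  proof
    fix x
    have "(\<Sum>k<d. y k * of_bool (x = k)) = (\<Sum>k<d. if x = k then y x else 0)"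
      by (rule sum.cong) auto
    also have "\<dots> = y x"
      using \<open>y \<in> topspace (Euclidean_space d)\<close> by (simp add: topspace_Euclidean_space)
    finally show "y x = (\<Sum>k<d. y k *\<^sub>R ?e k) x" by (simp add: sum_fun_eval)
  qed
  then have "h y = h (\<Sum>k<d. y k *\<^sub>R ?e k)" by (rule arg_cong)
  also have "\<dots> = (\<Sum>k<d. y k * h (?e k))"
    using assms by (simp add: linear_sum linear_scale)
  finally have "h y = (\<Sum>k<d. y k * h (?e k))" .
  then show "h y = dot d (\<lambda>k. if k < d then h (?e k) else 0) y"
    by (simp add: dot_def mult.commute)
qed

text \<open>
  A vertex \<open>v\<close> of the dual is a lattice point with \<open>dot d v q < 1\<close>, so \<open>dot d v q \<le> 0\<close>. As a small positive
  multiple of \<open>q\<close> lies in the dual, \<open>dot d q q \<le> 0\<close>.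
\<close>

lemma centered_reflexive_interior_point:
  fixes w :: "'i \<Rightarrow> real"
  assumes refl: "centered_reflexive d Q"
    and Q: "F ` I \<subseteq> Q" "Q \<subseteq> convex hull (F ` I)" and "finite I"
    and w: "\<And>i. i \<in> I \<Longrightarrow> 0 < w i" "(\<Sum>i\<in>I. w i) = 1"
    and q: "q \<in> int_points d" "q = (\<Sum>i\<in>I. w i *\<^sub>R F i)"
  shows "q = 0"
proof -
  obtain V where V: "finite V" "V \<subseteq> int_points d" "dual_polytope d Q = convex hull V"
    using refl unfolding centered_reflexive_def lattice_polytope_def by blast
  have "0 \<in> Euclidean_space d interior_of Q"
    using refl unfolding centered_reflexive_def by simp
  then have zero: "0 \<in> Q" by (rule subsetD [OF interior_of_subset])
  have "dot d q v \<le> 0" if "v \<in> V" for v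
  proof -
    have v: "dot d v y \<le> 1" if "y \<in> Q" for y
      using that \<open>v \<in> V\<close> V(3) dual_polytope_iff hull_inc by metis
    have sum1: "(\<Sum>i\<in>I. w i * (1 - dot d v (F i))) = 1 - dot d v q"
      unfolding q(2) by (simp add: dot_sum_right dot_scale_right algebra_simps sum_subtractf w(2))
    have nonneg: "0 \<le> w i * (1 - dot d v (F i))" if "i \<in> I" for i
      using w(1) [OF that] v [of "F i"] Q(1) that by auto
    \<comment> \<open>As all \<open>w i\<close> are positive, equality would put every
      \<open>F i\<close>, and hence all of \<open>Q\<close>, on the hyperplane where
      \<open>dot d v\<close> equals 1; but \<open>Q\<close> contains the origin.\<close>
    have "dot d v q \<noteq> 1"
    proof
      assume "dot d v q = 1"
      then have "\<forall>i\<in>I. w i * (1 - dot d v (F i)) = 0"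
        using sum_nonneg_eq_0_iff [OF \<open>finite I\<close> nonneg] sum1 by simp
      then have "\<forall>i\<in>I. dot d v (F i) = 1"
        using w(1) by force
      then have "dot d (- v) y \<le> - 1" if "y \<in> F ` I" for y
        using that by (auto simp: dot_def sum_negf)
      then have "dot d (- v) 0 \<le> - 1"
        using dot_le_convex_hull zero Q(2) by blast
      then show False by simp
    qed
    moreover have "dot d v q \<le> 1"
    proof -
      have "0 \<le> (\<Sum>i\<in>I. w i * (1 - dot d v (F i)))" by (intro sum_nonneg nonneg)
      then show ?thesis unfolding sum1 by simp
    qed
    moreover have "dot d v q \<in> \<int>"
      using dot_int_points V(2) that q(1) by blast
    ultimately show ?thesis
      by (auto elim!: Ints_cases simp: dot_commute [of d q])
  qed
  then have le0: "dot d q u \<le> 0" if "u \<in> dual_polytope d Q" for u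
    using that dot_le_convex_hull V(3) by metis
  \<comment> \<open>The factor \<open>1 / M\<close> scales \<open>q\<close> into the dual; the
    summand 1 keeps \<open>M\<close> positive.\<close>
  define M where "M = 1 + (\<Sum>i\<in>I. \<bar>dot d q (F i)\<bar>)"
  have "0 < M" unfolding M_def by (intro add_pos_nonneg sum_nonneg) auto
  have "(1 / M) *\<^sub>R q \<in> dual_polytope d Q"
    unfolding dual_polytope_iff
  proof (intro conjI ballI)
    show "(1 / M) *\<^sub>R q \<in> topspace (Euclidean_space d)"
      using q(1) by (simp add: int_points_def topspace_Euclidean_space)
    fix y assume "y \<in> Q"
    have "dot d q (F i) \<le> M" if "i \<in> I" for i
      using member_le_sum [OF that, of "\<lambda>i. \<bar>dot d q (F i)\<bar>"] \<open>finite I\<close>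
      unfolding M_def by fastforce
    then have "dot d q y \<le> M"
      using dot_le_convex_hull [of "F ` I"] \<open>y \<in> Q\<close> Q(2) by blast
    then show "dot d ((1 / M) *\<^sub>R q) y \<le> 1"
      using \<open>0 < M\<close> by (simp add: dot_commute [of d _ y] dot_scale_right field_simps)
  qed
  from le0 [OF this] have "dot d q q \<le> 0"
    using \<open>0 < M\<close> by (simp add: dot_scale_right divide_le_0_iff)
  then have "(\<Sum>i<d. q i * q i) = 0"
    unfolding dot_def by (intro antisym sum_nonneg) auto
  then have "\<forall>i<d. q i = 0"
    by (subst (asm) sum_nonneg_eq_0_iff) auto
  moreover have "\<forall>i\<ge>d. q i = 0"
    using q(1) by (simp add: int_points_def topspace_Euclidean_space)
  ultimately show ?thesis
    by (metis ext not_le zero_fun_apply)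
qed

text \<open>
  The facet opposite to \<open>F j\<close> is defined by a vertex of the dual polytope. As this vertex is a lattice
  point, its value \<open>1 - (\<Sum>w) / w j\<close> at \<open>F j\<close> is an integer.
\<close>

lemma centered_reflexive_simplex_dvd:
  fixes w :: "'i \<Rightarrow> nat"
  assumes refl: "centered_reflexive d Q"
    and Q: "F ` I \<subseteq> Q" "Q \<subseteq> convex hull (F ` I)" "F ` I \<subseteq> int_points d"
    and "finite I" and inj: "inj_on F I"
    and w: "\<And>i. i \<in> I \<Longrightarrow> 0 < w i" "(\<Sum>i\<in>I. real (w i) *\<^sub>R F i) = 0"
    and kernel: "\<And>l. (\<Sum>i\<in>I. l i *\<^sub>R F i) = 0 \<Longrightarrow> \<exists>t. \<forall>i\<in>I. l i = t * real (w i)"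
    and j: "j \<in> I"
  shows "w j dvd (\<Sum>i\<in>I. w i)"
proof -
  define N where "N = (\<Sum>i\<in>I. w i)"
  have Nj: "(\<Sum>i\<in>I - {j}. real (w i)) = real N - real (w j)"
    using \<open>finite I\<close> j by (simp add: N_def sum_diff1)
  \<comment> \<open>A relation that omits \<open>F j\<close> is a multiple of the weights with value
    0 at \<open>j\<close>, hence trivial.\<close>
  have indep: "independent (F ` (I - {j}))"
  proof (rule independent_if_scalars_zero)
    show "finite (F ` (I - {j}))" using \<open>finite I\<close> by simp
    fix c x assume c: "(\<Sum>x\<in>F ` (I - {j}). c x *\<^sub>R x) = 0" and "x \<in> F ` (I - {j})"
    then obtain i where i: "i \<in> I" "i \<noteq> j" "x = F i" by blast
    have "(\<Sum>i\<in>I. (if i = j then 0 else c (F i)) *\<^sub>R F i) = (\<Sum>i\<in>I - {j}. c (F i) *\<^sub>R F i)"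
      by (rule sum.mono_neutral_cong_right) (use \<open>finite I\<close> in auto)
    also have "\<dots> = (\<Sum>x\<in>F ` (I - {j}). c x *\<^sub>R x)"
      by (subst sum.reindex) (use inj in \<open>auto intro: inj_on_subset\<close>)
    finally obtain t where t: "\<forall>i\<in>I. (if i = j then 0 else c (F i)) = t * real (w i)"
      using kernel [of "\<lambda>i. if i = j then 0 else c (F i)"] c by auto
    then have "t = 0" using j w(1) [OF j] by auto
    then show "c x = 0" using t i by auto
  qed
  \<comment> \<open>This functional defines the facet opposite to \<open>F j\<close>.\<close>
  then obtain h :: "(nat \<Rightarrow> real) \<Rightarrow> real"
    where h: "linear h" "\<forall>x\<in>F ` (I - {j}). h x = 1"
    using linear_independent_extend [of "F ` (I - {j})" "\<lambda>_. 1"] by blast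
  obtain u where u: "u \<in> topspace (Euclidean_space d)"
    "\<And>y. y \<in> topspace (Euclidean_space d) \<Longrightarrow> h y = dot d u y"
    using linear_functional_dot [OF h(1)] by blast
  have F_top: "F i \<in> topspace (Euclidean_space d)" if "i \<in> I" for i
    using Q(3) that by (auto simp: int_points_def)
  \<comment> \<open>Pairing the relation with a functional that is 1 on the facet leaves only its
    value at \<open>F j\<close> to be determined.\<close>
  have value_j: "real (w j) * dot d v (F j) = real (w j) - real N"
    if "\<And>i. i \<in> I - {j} \<Longrightarrow> dot d v (F i) = 1" for v
  proof -
    have "0 = (\<Sum>i\<in>I. real (w i) * dot d v (F i))"
      using arg_cong [OF w(2), of "dot d v"] by (simp add: dot_sum_right dot_scale_right)
    also have "\<dots> = real (w j) * dot d v (F j) + (\<Sum>i\<in>I - {j}. real (w i) * dot d v (F i))"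
      using \<open>finite I\<close> j by (rule sum.remove)
    also have "(\<Sum>i\<in>I - {j}. real (w i) * dot d v (F i)) = real N - real (w j)"
      unfolding Nj [symmetric] by (rule sum.cong) (use that in auto)
    finally show ?thesis by simp
  qed
  have u1: "dot d u (F i) = 1" if "i \<in> I - {j}" for i
    using h(2) u(2) [OF F_top] that by auto
  have "real (w j) * dot d u (F j) \<le> real (w j) * 1"
    using value_j [OF u1] by simp
  then have "dot d u (F j) \<le> 1"
    using w(1) [OF j] by (subst (asm) mult_le_cancel_left_pos) auto
  then have "dot d u (F i) \<le> 1" if "i \<in> I" for i
    using that u1 by (cases "i = j") auto
  then have "dot d u y \<le> 1" if "y \<in> F ` I" for y
    using that by blast
  then have "u \<in> dual_polytope d Q"
    unfolding dual_polytope_iff using u(1) dot_le_convex_hull Q(2) by blast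
  moreover obtain V where V: "finite V" "V \<subseteq> int_points d" "dual_polytope d Q = convex hull V"
    using refl unfolding centered_reflexive_def lattice_polytope_def by blast
  ultimately obtain a where a: "\<forall>v\<in>V. 0 \<le> a v" "(\<Sum>v\<in>V. a v) = 1" "(\<Sum>v\<in>V. a v *\<^sub>R v) = u"
    unfolding convex_hull_finite [OF V(1)] by auto
  have "\<exists>v\<in>V. a v \<noteq> 0" using a(2) by (metis sum.neutral zero_neq_one)
  \<comment> \<open>A generator \<open>v\<close> with positive coefficient in \<open>u\<close> also
    takes the value 1 on the facet, because the values of the generators there are at most 1 and
    have weighted mean 1. Unlike \<open>u\<close>, it is known to be integral.\<close>
  then obtain v where v: "v \<in> V" "0 < a v" using a(1) by force
  have "dot d v (F i) = 1" if i: "i \<in> I - {j}" for i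
  proof -
    have le: "dot d v' (F i) \<le> 1" if "v' \<in> V" for v'
    proof -
      have "v' \<in> dual_polytope d Q" using that V(3) hull_inc by metis
      then show ?thesis using i Q(1) unfolding dual_polytope_iff by blast
    qed
    have "(\<Sum>v\<in>V. a v * dot d v (F i)) = 1"
      using u1 [OF i] unfolding a(3) [symmetric] dot_commute [of d _ "F i"] dot_sum_right dot_scale_right .
    then have "(\<Sum>v\<in>V. a v * (1 - dot d v (F i))) = 0"
      using a(2) by (simp add: algebra_simps sum_subtractf)
    then have "a v * (1 - dot d v (F i)) = 0"
      by (subst (asm) sum_nonneg_eq_0_iff) (use V(1) a(1) le v(1) in auto)
    then show ?thesis using v(2) by simp
  qed
  then have eq: "real (w j) * dot d v (F j) = real (w j) - real N" by (rule value_j)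
  have "dot d v (F j) \<in> \<int>" using dot_int_points V(2) v(1) Q(3) j by blast
  then obtain z where "dot d v (F j) = of_int z" by (elim Ints_cases)
  with eq have "of_int (int (w j) * z) = (of_int (int (w j) - int N) :: real)" by simp
  then have "int (w j) * z = int (w j) - int N" by (simp only: of_int_eq_iff)
  then have "int N = int (w j) * (1 - z)" by (simp add: algebra_simps)
  then have "int (w j) dvd int N" by simp
  then show ?thesis by (simp add: N_def del: of_nat_sum)
qed

text \<open>The map \<open>f - f 0\<close> is linear on \<open>A\<close>: affine combinations with
  the origin give homogeneity, and doubling the midpoint gives additivity.\<close>

lemma affine_map_on_linear:
  assumes "affine_map_on A f" and A: "subspace A"
    and "\<And>i. i \<in> I \<Longrightarrow> g i \<in> A" "finite I"
  shows "f (\<Sum>i\<in>I. l i *\<^sub>R g i) - f 0 = (\<Sum>i\<in>I. l i *\<^sub>R (f (g i) - f 0))"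
proof -
  have aff: "f (u *\<^sub>R x + v *\<^sub>R y) = u *\<^sub>R f x + v *\<^sub>R f y" if "x \<in> A" "y \<in> A" "u + v = 1" for x y u v
    using assms(1) that unfolding affine_map_on_def by blast
  have f_scale: "f (c *\<^sub>R x) - f 0 = c *\<^sub>R (f x - f 0)" if "x \<in> A" for x c
    using aff [OF that subspace_0 [OF A], of c "1 - c"] by (simp add: algebra_simps)
  have f_add: "f (x + y) - f 0 = (f x - f 0) + (f y - f 0)" if "x \<in> A" "y \<in> A" for x y
  proof -
    have "f (x + y) - f 0 = f (2 *\<^sub>R ((1/2) *\<^sub>R x + (1/2) *\<^sub>R y)) - f 0"
      by (simp add: scaleR_add_right)
    also have "\<dots> = 2 *\<^sub>R (f ((1/2) *\<^sub>R x + (1/2) *\<^sub>R y) - f 0)"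
      by (intro f_scale subspace_add subspace_scale A that)
    also have "\<dots> = 2 *\<^sub>R ((1/2) *\<^sub>R f x + (1/2) *\<^sub>R f y - f 0)"
      using aff [OF that, of "1/2" "1/2"] by simp
    also have "\<dots> = (f x - f 0) + (f y - f 0)"
      by (simp add: algebra_simps scaleR_2)
    finally show ?thesis .
  qed
  from \<open>finite I\<close> assms(3) have "(\<Sum>i\<in>I. l i *\<^sub>R g i) \<in> A \<and> ?thesis"
  proof (induction I rule: finite_induct)
    case empty
    show ?case unfolding sum.empty by (intro conjI subspace_0 [OF A]) simp
  next
    case (insert i I)
    then have IH: "(\<Sum>i\<in>I. l i *\<^sub>R g i) \<in> A"
      "f (\<Sum>i\<in>I. l i *\<^sub>R g i) - f 0 = (\<Sum>i\<in>I. l i *\<^sub>R (f (g i) - f 0))" by blast+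
    have "g i \<in> A" using insert by blast
    then have gi: "l i *\<^sub>R g i \<in> A" by (rule subspace_scale [OF A])
    show ?case
      unfolding sum.insert [OF insert.hyps] f_add [OF gi IH(1)] IH(2) f_scale [OF \<open>g i \<in> A\<close>]
      by (intro conjI subspace_add [OF A gi IH(1)] refl)
  qed
  then show ?thesis ..
qed

lemma subspace_sum_zero_hyperplane: "subspace (sum_zero_hyperplane n)"
  by (auto simp: subspace_def sum_zero_hyperplane_def topspace_Euclidean_space sum.distrib
      simp flip: sum_distrib_left)

context cycle_laplacian
begin

text \<open>A priori the equivalence \<open>f\<close> may move the origin. Since \<open>f 0\<close>
  is a lattice point and a combination of the images of the rows with positive coefficients,
  \<open>centered_reflexive_interior_point\<close> yields \<open>f 0 = 0\<close>. Thus the images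
  satisfy the same relations as the rows, and the divisibility for simplices applies.\<close>

lemma reflexive_weight_dvd:
  assumes refl: "reflexive_polytope n (sum_zero_hyperplane n) P"
    and j: "j \<in> {1..n}"
  shows "weight j dvd total"
proof -
  let ?H = "sum_zero_hyperplane n"
  obtain d Q f where Q: "centered_reflexive d Q" and f: "affine_map_on ?H f"
    "bij_betw f ?H (topspace (Euclidean_space d))"
    "f ` \<Lambda> = topspace (Euclidean_space d) \<inter> int_points d" "f ` P = Q"
    using refl unfolding reflexive_polytope_def unimodularly_equivalent_def by blast
  define F where "F = (\<lambda>i. f (row i))"
  have row_H: "row i \<in> ?H" if "i \<in> {1..n}" for i using row_in_lattice [OF that] by blast
  have zero_H: "0 \<in> ?H" using zero_in_lattice by blast
  have f_comb: "f (comb l) - f 0 = (\<Sum>i\<in>{1..n}. l i *\<^sub>R (F i - f 0))" for l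
    unfolding comb_def F_def
    by (rule affine_map_on_linear [OF f(1) subspace_sum_zero_hyperplane row_H]) simp_all
  have F_Q: "F ` {1..n} \<subseteq> Q" using row_in_polytope f(4) unfolding F_def by blast
  have F_int: "F ` {1..n} \<subseteq> int_points d" using row_in_lattice f(3) unfolding F_def by blast
  have Q_hull: "Q \<subseteq> convex hull (F ` {1..n})"
  proof
    fix y assume "y \<in> Q"
    then obtain x where "x \<in> P" "y = f x" using f(4) by blast
    then obtain l where l: "\<forall>i\<in>{1..n}. 0 \<le> l i" "(\<Sum>i\<in>{1..n}. l i) = 1" "y = f (comb l)"
      unfolding polytope_eq by blast
    have "y = (\<Sum>i\<in>{1..n}. l i *\<^sub>R F i)"
      using f_comb [of l] l by (simp add: scaleR_diff_right sum_subtractf flip: scaleR_sum_left)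
    also have "\<dots> \<in> convex hull (F ` {1..n})"
      using l by (intro convex_sum) (auto intro: hull_inc simp: convex_convex_hull)
    finally show "y \<in> convex hull (F ` {1..n})" .
  qed
  \<comment> \<open>Barycentric coordinates of the origin.\<close>
  let ?w = "\<lambda>i. (1 / real total) * real (weight i)"
  have sum_w: "(\<Sum>i\<in>{1..n}. ?w i) = 1"
    unfolding sum_distrib_left [symmetric] sum_weight using total_pos by simp
  have "f 0 = 0"
  proof (rule centered_reflexive_interior_point [OF Q F_Q Q_hull _ _ sum_w])
    show "0 < ?w i" for i using total_pos weight_pos by simp
    show "f 0 \<in> int_points d" using zero_in_lattice f(3) by blast
    have "0 = (\<Sum>i\<in>{1..n}. ?w i *\<^sub>R (F i - f 0))"
      using f_comb [of ?w] unfolding comb_scale comb_weight by simp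
    also have "\<dots> = (\<Sum>i\<in>{1..n}. ?w i *\<^sub>R F i) - (\<Sum>i\<in>{1..n}. ?w i) *\<^sub>R f 0"
      by (simp add: scaleR_diff_right sum_subtractf scaleR_sum_left)
    finally show "f 0 = (\<Sum>i\<in>{1..n}. ?w i *\<^sub>R F i)" unfolding sum_w by simp
  qed simp
  then have f_comb': "f (comb l) = (\<Sum>i\<in>{1..n}. l i *\<^sub>R F i)" for l
    using f_comb [of l] by simp
  have inj_f: "inj_on f ?H" using f(2) by (rule bij_betw_imp_inj_on)
  show ?thesis
    unfolding total_def
  proof (rule centered_reflexive_simplex_dvd [OF Q F_Q Q_hull F_int _ _ weight_pos _ _ j])
    show "inj_on F {1..n}"
    proof (rule inj_onI)
      fix i k assume ik: "i \<in> {1..n}" "k \<in> {1..n}" "F i = F k"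
      then have "row i = row k" using inj_onD [OF inj_f] row_H unfolding F_def by blast
      then have "comb (\<lambda>x. of_bool (x = i)) = comb (\<lambda>x. of_bool (x = k))"
        using ik by (simp add: comb_unit del: One_nat_def atLeastAtMost_iff)
      then have "(of_bool (i = i) :: real) = of_bool (i = k)"
        by (rule comb_inj [OF _ _ ik(1)]) (simp only: sum_unit ik)
      then show "i = k" by simp
    qed
    show "(\<Sum>i\<in>{1..n}. real (weight i) *\<^sub>R F i) = 0"
      using f_comb' [of "\<lambda>i. real (weight i)"] comb_weight \<open>f 0 = 0\<close> by simp
    fix l assume "(\<Sum>i\<in>{1..n}. l i *\<^sub>R F i) = 0"
    then have "f (comb l) = f 0" using f_comb' \<open>f 0 = 0\<close> by simp
    then have "comb l = 0" using inj_onD [OF inj_f] comb_in_hyperplane zero_H by blast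
    then show "\<exists>t. \<forall>i\<in>{1..n}. l i = t * real (weight i)"
      using kernel_coefficients by metis
  qed simp
qed

end

section \<open>Cases with the integer decomposition property\<close>

lemma unit_interval_congruent:
  fixes x y :: real
  assumes "x - y \<in> \<int>" "0 \<le> x" "x < 1" "0 \<le> y" "y < 1"
  shows "x = y"
proof -
  obtain z where z: "x - y = of_int z" using assms(1) by (elim Ints_cases)
  then have "real_of_int z < 1" "- 1 < real_of_int z" using assms by linarith+
  then have "z = 0" by linarith
  then show ?thesis using z by simp
qed

context cycle_laplacian
begin

text \<open>Without backward arcs the flow is \<open>l\<close> itself, so coefficients in the unit
  interval are congruent, hence all equal to \<open>m / n\<close>, while the weights are 1 and add
  up to \<open>n\<close>.\<close>

lemma integer_decomposition_empty:
  assumes "S = {}"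
  shows "integer_decomposition_property \<Lambda> P"
proof (rule integer_decompositionI)
  fix m :: nat and l i
  assume m: "2 \<le> m" and nonneg: "\<And>i. i \<in> {1..n} \<Longrightarrow> 0 \<le> l i"
    and less: "\<And>i. i \<in> {1..n} \<Longrightarrow> l i < 1"
    and sum: "(\<Sum>i\<in>{1..n}. l i) = real m" and lat: "comb l \<in> \<Lambda>" and i: "i \<in> {1..n}"
  have "S \<noteq> {1..n}" using assms n_ge_3 by auto
  then have weight: "weight k = 1" for k using weight_rec assms by (metis empty_iff)
  have flow: "flow l k = l k" for k using assms unfolding flow_def by simp
  have "l k = l i" if "k \<in> {1..n}" for k
    using flow_cong_int [OF lat i that] that i nonneg less unfolding flow
    by (intro unit_interval_congruent) auto
  then have "(\<Sum>k\<in>{1..n}. l k) = (\<Sum>k\<in>{1..n}. l i)" by (intro sum.cong) auto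
  then have "l i * real n = real m" using sum by (simp add: mult.commute)
  then show "real (weight i) \<le> l i * real total" using m by (simp add: total_def weight)
qed

text \<open>
  With \<open>N\<close> the sum of the weights \<open>w\<close>, the numbers \<open>l i * N / w i\<close> are nonnegative integers smaller
  than \<open>N / w i\<close>. If one of them vanishes, then \<open>m < 2\<close>.
\<close>

lemma integer_decomposition_3:
  assumes refl: "reflexive_polytope n (sum_zero_hyperplane n) P" and n: "n = 3"
  shows "integer_decomposition_property \<Lambda> P"
proof (rule integer_decompositionI, rule ccontr)
  fix m :: nat and l i
  assume m: "2 \<le> m" and nonneg: "\<And>i. i \<in> {1..n} \<Longrightarrow> 0 \<le> l i"
    and less: "\<And>i. i \<in> {1..n} \<Longrightarrow> l i < 1"
    and sum: "(\<Sum>i\<in>{1..n}. l i) = real m" and lat: "comb l \<in> \<Lambda>" and i: "i \<in> {1..n}"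
    and "\<not> real (weight i) \<le> l i * real total"
  define N where "N = real total"
  have small: "l i * N < real (weight i)" using \<open>\<not> _\<close> unfolding N_def by simp
  have multiple: "\<exists>z::int. l k * N = of_int z * real (weight k)" if k: "k \<in> {1..n}" for k
  proof (cases "S = {1..n}")
    case True
    note flow = flow_full [OF True]
    have "k = 1 \<or> k = 2 \<or> k = 3" using k unfolding n by auto
    then have "\<sigma> (\<sigma> (\<sigma> k)) = k" "{1..n} = {k, \<sigma> k, \<sigma> (\<sigma> k)}"
      unfolding next_vertex_def unfolding n by auto
    moreover have "\<sigma> k \<noteq> k" "\<sigma> (\<sigma> k) \<noteq> k" "\<sigma> (\<sigma> k) \<noteq> \<sigma> k"
      using next_vertex_neq k next_vertex_in by blast+
    ultimately have "l k + l (\<sigma> k) + l (\<sigma> (\<sigma> k)) = real m"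
      using sum by simp
    \<comment> \<open>The vertex \<open>\<sigma> (\<sigma> k)\<close> precedes \<open>k\<close>, so
      the difference of the two flows is \<open>2 * l k\<close> minus the other two
      coefficients.\<close>
    then have "l k * 3 = (flow l k - flow l (\<sigma> (\<sigma> k))) + real m"
      using \<open>\<sigma> (\<sigma> (\<sigma> k)) = k\<close> by (simp add: flow)
    also have "\<dots> \<in> \<int>"
      by (intro Ints_add flow_cong_int [OF lat] next_vertex_in k Ints_of_nat)
    finally obtain z where "l k * 3 = of_int z" by (elim Ints_cases)
    then show ?thesis unfolding N_def total_def weight_full [OF True]
      by (intro exI [of _ z]) (simp add: n)
  next
    case False
    obtain t where t: "\<And>i. i \<in> {1..n} \<Longrightarrow> l i - t * real (weight i) \<in> \<int>"
      using lattice_coefficients [OF False lat] by blast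
    have "t * N = real m - (\<Sum>i\<in>{1..n}. l i - t * real (weight i))"
      unfolding sum_subtractf sum sum_distrib_left [symmetric] sum_weight N_def by simp
    also have "\<dots> \<in> \<int>" by (intro Ints_diff Ints_of_nat Ints_sum t)
    finally obtain z where z: "t * N = of_int z" by (elim Ints_cases)
    obtain a where a: "l k - t * real (weight k) = of_int a" using t [OF k] by (elim Ints_cases)
    obtain r where r: "total = weight k * r" using reflexive_weight_dvd [OF refl k] ..
    \<comment> \<open>Both summands are integral multiples of \<open>weight k\<close>, the first one
      by reflexivity.\<close>
    have "l k * N = of_int a * N + t * N * real (weight k)" using a by (simp add: algebra_simps)
    also have "\<dots> = of_int (a * int r + z) * real (weight k)"
      unfolding z by (simp add: N_def r algebra_simps)
    finally show ?thesis by blast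
  qed
  have "l i = 0"
  proof -
    obtain z where z: "l i * N = of_int z * real (weight i)" using multiple [OF i] ..
    have "0 < N" using total_pos by (simp add: N_def)
    have "of_int z * real (weight i) < 1 * real (weight i)" using small z by simp
    then have "z < 1" using weight_pos [of i] by (simp only: mult_less_cancel_right_disj) simp
    have "0 \<le> of_int z * real (weight i)" using nonneg [OF i] \<open>0 < N\<close> unfolding z [symmetric] by simp
    then have "0 \<le> z" using weight_pos [of i] by (simp add: zero_le_mult_iff)
    with \<open>z < 1\<close> have "z = 0" by linarith
    with z \<open>0 < N\<close> show ?thesis by simp
  qed
  \<comment> \<open>Both \<open>l k * N\<close> and \<open>N\<close> are multiples of
    \<open>weight k\<close>, so the strict inequality between them leaves a gap of at least one
    weight.\<close>
  have gap: "l k * N \<le> N - real (weight k)" if k: "k \<in> {1..n}" for k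
  proof -
    have "0 < N" using total_pos by (simp add: N_def)
    obtain z where z: "l k * N = of_int z * real (weight k)" using multiple [OF k] ..
    obtain r where r: "total = weight k * r" using reflexive_weight_dvd [OF refl k] ..
    have "l k * N < N" using less [OF k] \<open>0 < N\<close> by simp
    then have "of_int z * real (weight k) < real r * real (weight k)"
      unfolding z by (simp add: N_def r mult.commute)
    then have "real_of_int z < real r" using weight_pos [of k] by simp
    then have "z + 1 \<le> int r" by linarith
    then have "real_of_int z + 1 \<le> real r" by linarith
    then have "(real_of_int z + 1) * real (weight k) \<le> real r * real (weight k)"
      by (intro mult_right_mono) auto
    then show ?thesis unfolding z by (simp add: N_def r algebra_simps)
  qed
  have "real m * N = (\<Sum>k\<in>{1..n}. l k * N)" by (simp only: sum [symmetric] sum_distrib_right)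
  also have "\<dots> = (\<Sum>k\<in>{1..n} - {i}. l k * N)"
    using i \<open>l i = 0\<close> by (simp add: sum.remove [of _ i])
  also have "\<dots> \<le> (\<Sum>k\<in>{1..n} - {i}. N - real (weight k))"
    by (intro sum_mono gap) simp
  also have "\<dots> = 2 * N - (N - real (weight i))"
  proof -
    have "card ({1..n} - {i}) = 2" using i by (simp add: n)
    then have "(\<Sum>k\<in>{1..n} - {i}. N) = 2 * N" by simp
    moreover have "(\<Sum>k\<in>{1..n} - {i}. real (weight k)) = N - real (weight i)"
      using i sum_diff1 [of "{1..n}" "\<lambda>k. real (weight k)" i] unfolding sum_weight N_def by simp
    ultimately show ?thesis by (simp only: sum_subtractf)
  qed
  also have "\<dots> < 2 * N"
  proof -
    have "weight (\<sigma> i) + weight i \<le> (\<Sum>k\<in>{1..n}. weight k)"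
      using sum_mono2 [of "{1..n}" "{\<sigma> i, i}" weight] i next_vertex_in next_vertex_neq(1) [OF i] by simp
    then have "weight i < total" using weight_pos [of "\<sigma> i"] unfolding total_def by linarith
    then show ?thesis by (simp add: N_def)
  qed
  finally have "real m < 2" using total_pos by (simp add: N_def)
  then show False using m by simp
qed

text \<open>The congruences compare flows for alternating \<open>S\<close>; \<open>a\<close> and
  \<open>c\<close> have weight 1, \<open>b\<close> and \<open>d\<close> weight 2, and 6 is the sum
  of the weights. They give \<open>a = c\<close>, \<open>b = d\<close> and \<open>d - 2 * a\<close>
  equal to 0 or -1, so that the sum \<open>m\<close> is \<open>6 * a\<close> or
  \<open>6 * a - 2\<close>.\<close>

lemma alternating_coefficients:
  fixes a b c d :: real and m :: nat
  assumes "0 \<le> a" "a < 1" "0 \<le> b" "b < 1" "0 \<le> c" "c < 1" "0 \<le> d" "d < 1"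
    and "a - c \<in> \<int>" "(b - c) - a \<in> \<int>" "(d - a) - a \<in> \<int>"
    and sum: "a + b + c + d = real m" and "2 \<le> m"
  shows "1 \<le> 6 * a \<and> 2 \<le> 6 * b \<and> 1 \<le> 6 * c \<and> 2 \<le> 6 * d"
proof -
  have "a = c" using assms by (intro unit_interval_congruent) auto
  have "b - d = ((b - c) - a) - ((d - a) - a)" using \<open>a = c\<close> by simp
  also have "\<dots> \<in> \<int>" by (intro Ints_diff assms)
  finally have "b = d" using assms by (intro unit_interval_congruent) auto
  obtain z where z: "(d - a) - a = of_int z" using assms(11) by (elim Ints_cases)
  have "real_of_int z < 1" "real_of_int z > - 2" using z assms by linarith+
  then have "z = 0 \<or> z = - 1" by linarith
  moreover have "2 \<le> real m" using \<open>2 \<le> m\<close> by simp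
  ultimately show ?thesis using z sum \<open>a = c\<close> \<open>b = d\<close> by auto
qed

lemma integer_decomposition_4:
  assumes n: "n = 4" and S: "S = {1, 3} \<or> S = {2, 4}"
  shows "integer_decomposition_property \<Lambda> P"
proof (rule integer_decompositionI)
  fix m :: nat and l i
  assume m: "2 \<le> m" and nonneg: "\<And>i. i \<in> {1..n} \<Longrightarrow> 0 \<le> l i"
    and less: "\<And>i. i \<in> {1..n} \<Longrightarrow> l i < 1"
    and sum: "(\<Sum>i\<in>{1..n}. l i) = real m" and lat: "comb l \<in> \<Lambda>" and i: "i \<in> {1..n}"
  have V: "{1..n} = {1, 2, 3, 4}" using n by auto
  have succ: "\<sigma> 1 = 2" "\<sigma> 2 = 3" "\<sigma> 3 = 4" "\<sigma> 4 = 1" unfolding next_vertex_def unfolding n by simp_all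
  have "S \<noteq> {1..n}" using S unfolding V by auto
  note w = weight_rec [OF this]
  have int: "flow l j - flow l k \<in> \<int>" if "j \<in> {1, 2, 3, 4}" "k \<in> {1, 2, 3, 4}" for j k
    using flow_cong_int [OF lat] that unfolding V by blast
  have box: "0 \<le> l k \<and> l k < 1" if "k \<in> {1, 2, 3, 4}" for k
    using nonneg less that unfolding V by blast
  have sum': "l 1 + l 2 + l 3 + l 4 = real m" using sum unfolding V by simp
  from S show "real (weight i) \<le> l i * real total"
  proof
    assume "S = {1, 3}"
    then have S: "1 \<in> S" "2 \<notin> S" "3 \<in> S" "4 \<notin> S" by simp_all
    have "weight 1 = 1" "weight 3 = 1" using S w [of 1] w [of 3] unfolding succ by simp_all
    moreover from this have "weight 2 = 2" "weight 4 = 2"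
      using S w [of 2] w [of 4] unfolding succ by simp_all
    moreover have "1 \<le> 6 * l 1 \<and> 2 \<le> 6 * l 2 \<and> 1 \<le> 6 * l 3 \<and> 2 \<le> 6 * l 4"
      by (rule alternating_coefficients [OF _ _ _ _ _ _ _ _ _ _ _ _ m])
        (use S box int [of 1 3] int [of 2 1] int [of 4 1] sum' in
          \<open>simp_all add: flow_def succ del: One_nat_def\<close>)
    ultimately show ?thesis using i unfolding total_def V by auto
  next
    assume "S = {2, 4}"
    then have S: "1 \<notin> S" "2 \<in> S" "3 \<notin> S" "4 \<in> S" by simp_all
    have "weight 2 = 1" "weight 4 = 1" using S w [of 2] w [of 4] unfolding succ by simp_all
    moreover from this have "weight 3 = 2" "weight 1 = 2"
      using S w [of 3] w [of 1] unfolding succ by simp_all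
    moreover have "1 \<le> 6 * l 2 \<and> 2 \<le> 6 * l 3 \<and> 1 \<le> 6 * l 4 \<and> 2 \<le> 6 * l 1"
      by (rule alternating_coefficients [OF _ _ _ _ _ _ _ _ _ _ _ _ m])
        (use S box int [of 2 4] int [of 3 2] int [of 1 2] sum' in
          \<open>simp_all add: flow_def succ del: One_nat_def\<close>)
    ultimately show ?thesis using i unfolding total_def V by auto
  qed
qed

section \<open>Necessary conditions\<close>

text \<open>Coefficients with a given sum are unique by \<open>comb_inj\<close>, so a decomposition
  of the point decomposes its coefficients as well.\<close>

lemma decomposition_coefficients:
  assumes idp: "integer_decomposition_property \<Lambda> P" and "0 < m"
    and l: "\<And>i. i \<in> {1..n} \<Longrightarrow> 0 \<le> l i" "(\<Sum>i\<in>{1..n}. l i) = real m" "comb l \<in> \<Lambda>"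
  obtains L where "\<And>k i. k < m \<Longrightarrow> i \<in> {1..n} \<Longrightarrow> 0 \<le> L k i"
    "\<And>k. k < m \<Longrightarrow> (\<Sum>i\<in>{1..n}. L k i) = 1" "\<And>k. k < m \<Longrightarrow> comb (L k) \<in> \<Lambda>"
    "\<And>i. i \<in> {1..n} \<Longrightarrow> l i = (\<Sum>k<m. L k i)"
proof -
  have "0 < real m" using \<open>0 < m\<close> by simp
  then have "comb l \<in> (\<lambda>p. real m *\<^sub>R p) ` P"
    unfolding scaled_polytope [OF \<open>0 < real m\<close>] using l by blast
  then obtain y where y: "\<forall>k<m. y k \<in> P \<inter> \<Lambda>" "comb l = (\<Sum>k<m. y k)"
    using idp \<open>0 < m\<close> l(3) unfolding integer_decomposition_property_def by blast
  have "\<exists>c. y k = comb c \<and> (\<forall>i\<in>{1..n}. 0 \<le> c i) \<and> (\<Sum>i\<in>{1..n}. c i) = 1" if "k < m" for k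
    using y(1) that unfolding polytope_eq by blast
  then obtain L where L: "\<And>k. k < m \<Longrightarrow>
      y k = comb (L k) \<and> (\<forall>i\<in>{1..n}. 0 \<le> L k i) \<and> (\<Sum>i\<in>{1..n}. L k i) = 1"
    by metis
  show thesis
  proof (rule that [of L])
    show "comb (L k) \<in> \<Lambda>" if "k < m" for k using y(1) L that by auto
    show "l i = (\<Sum>k<m. L k i)" if "i \<in> {1..n}" for i
    proof (rule comb_inj [OF _ _ that])
      show "comb l = comb (\<lambda>i. \<Sum>k<m. L k i)"
        unfolding comb_sum y(2) by (rule sum.cong) (use L in auto)
      have "(\<Sum>i\<in>{1..n}. \<Sum>k<m. L k i) = (\<Sum>k<m. \<Sum>i\<in>{1..n}. L k i)" by (rule sum.swap)
      also have "\<dots> = (\<Sum>k<m. 1)" by (rule sum.cong) (use L in auto)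
      finally show "(\<Sum>i\<in>{1..n}. l i) = (\<Sum>i\<in>{1..n}. \<Sum>k<m. L k i)" using l(2) by simp
    qed
  qed (use L in auto)
qed

text \<open>
  For \<open>S = {1..n}\<close> the differences \<open>l i - l (i + 1)\<close> of the coefficients of a lattice point agree
  modulo 1. The point with coefficients \<open>(i - 1) / n + \<delta>\<close> forces the difference \<open>- 1 / n\<close> on one of its
  summands, which makes the coefficients of this summand add up to at least \<open>(n - 1) / 2 > 1\<close>.
\<close>

lemma full_not_integer_decomposition:
  assumes S: "S = {1..n}" and n: "4 \<le> n"
  shows "\<not> integer_decomposition_property \<Lambda> P"
proof
  assume idp: "integer_decomposition_property \<Lambda> P"
  define m where "m = n div 2"
  \<comment> \<open>The shift makes the coefficients add up to \<open>m\<close>; it is 0 for odd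
    \<open>n\<close> and \<open>1 / (2 * n)\<close> for even \<open>n\<close>.\<close>
  define \<delta> where "\<delta> = (real m - (real n - 1) / 2) / real n"
  define l where "l = (\<lambda>i. real (i - 1) / real n + \<delta>)"
  have m: "real n - 1 \<le> 2 * real m" "2 * real m \<le> real n" unfolding m_def by linarith+
  have n_pos: "0 < real n" using n by simp
  have \<delta>: "0 \<le> \<delta>" "\<delta> < 1 / real n"
  proof -
    have "0 \<le> real m - (real n - 1) / 2" "real m - (real n - 1) / 2 < 1"
      using m by (auto simp: field_simps)
    then show "0 \<le> \<delta>" "\<delta> < 1 / real n"
      unfolding \<delta>_def using n_pos by (auto intro: divide_strict_right_mono divide_nonneg_pos)
  qed
  have one: "1 \<in> {1..n}" using n by simp
  note flow = flow_full [OF S]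
  have sum_lin: "(\<Sum>i\<in>{1..n}. real (i - 1)) = real n * (real n - 1) / 2"
  proof -
    have "(\<Sum>i\<in>{1..n}. real (i - 1)) = (\<Sum>i<n. real i)"
      by (rule sum.reindex_bij_witness [of _ Suc "\<lambda>i. i - 1"]) auto
    also have "\<dots> = real n * (real n - 1) / 2" by (induction n) (auto simp: field_simps)
    finally show ?thesis .
  qed
  have "(\<Sum>i\<in>{1..n}. l i) = real m"
    unfolding l_def sum.distrib sum_divide_distrib [symmetric] sum_lin
    using n_pos by (simp add: \<delta>_def field_simps)
  moreover have flow_l: "flow l i = (if i = n then 1 else 0) - 1 / real n" if "i \<in> {1..n}" for i
    using that n_pos unfolding flow l_def next_vertex_eq [OF that]
    by (auto simp: field_simps of_nat_diff)
  have "comb l \<in> \<Lambda>"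
    unfolding comb_in_lattice_iff using flow_l next_vertex_in by simp
  moreover have "0 \<le> l i" for i using \<delta> unfolding l_def by simp
  moreover have "0 < m" using n by (simp add: m_def)
  ultimately obtain L where L: "\<And>k i. k < m \<Longrightarrow> i \<in> {1..n} \<Longrightarrow> 0 \<le> L k i"
    "\<And>k. k < m \<Longrightarrow> (\<Sum>i\<in>{1..n}. L k i) = 1" "\<And>k. k < m \<Longrightarrow> comb (L k) \<in> \<Lambda>"
    "\<And>i. i \<in> {1..n} \<Longrightarrow> l i = (\<Sum>k<m. L k i)"
    using decomposition_coefficients [OF idp, of m l] by blast
  have le: "L k i \<le> l i" if "k < m" "i \<in> {1..n}" for k i
    unfolding L(4) [OF that(2)] using that L(1) by (intro member_le_sum) auto
  have two: "2 \<in> {1..n}" "\<sigma> 1 = 2" using n by (auto simp: next_vertex_def)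
  \<comment> \<open>The flows of a summand are congruent and sum to 0, so
    \<open>flow (L k) 1\<close> is a multiple of \<open>1 / n\<close>. The bounds by
    \<open>l\<close> at the vertices 1 and 2 leave only 0 and \<open>- 1 / n\<close>.\<close>
  have flow_0: "flow (L k) 1 = 0" if k: "k < m" for k
  proof -
    have "(\<Sum>i\<in>{1..n}. flow (L k) i) = 0"
      using sum.reindex_bij_betw [OF bij_next_vertex, of "L k"] by (simp add: flow sum_subtractf)
    then have "real n * flow (L k) 1 = (\<Sum>i\<in>{1..n}. flow (L k) 1 - flow (L k) i)"
      by (simp add: sum_subtractf)
    also have "\<dots> \<in> \<int>" by (intro Ints_sum flow_cong_int [OF L(3) [OF k]] one)
    finally obtain z where z: "real n * flow (L k) 1 = of_int z" by (elim Ints_cases)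
    have "- 2 / real n < flow (L k) 1"
      using le [OF k two(1)] L(1) [OF k one] \<delta> unfolding flow two l_def by (simp add: field_simps)
    moreover have "flow (L k) 1 < 1 / real n"
      using le [OF k one] L(1) [OF k two(1)] \<delta> unfolding flow two l_def by simp
    ultimately have "- 2 < real_of_int z" "real_of_int z < 1"
      unfolding z [symmetric] using n_pos by (simp_all add: field_simps)
    then have "z = 0 \<or> z = - 1" by linarith
    moreover have "z \<noteq> - 1"
    proof
      assume "z = - 1"
      then have flow_1: "flow (L k) 1 = - (1 / real n)" using z n_pos by (simp add: field_simps)
      \<comment> \<open>Modulo 1, the coefficients now increase by \<open>1 / n\<close> from each
        vertex to the next.\<close>
      have int: "Suc j \<le> n \<Longrightarrow> L k (Suc j) - L k 1 - real j / real n \<in> \<int>" for j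
      proof (induction j)
        case (Suc j)
        then have j: "Suc j \<in> {1..n}" "\<sigma> (Suc j) = Suc (Suc j)" by (auto simp: next_vertex_def)
        have "L k (Suc (Suc j)) - L k 1 - real (Suc j) / real n =
            (L k (Suc j) - L k 1 - real j / real n) - (flow (L k) (Suc j) - flow (L k) 1)"
          unfolding flow_1 unfolding flow j(2) using n_pos by (simp add: field_simps)
        also have "\<dots> \<in> \<int>"
        proof (rule Ints_diff)
          show "L k (Suc j) - L k 1 - real j / real n \<in> \<int>" using Suc by simp
        qed (intro flow_cong_int [OF L(3) [OF k]] one j)
        finally show ?case .
      qed simp
      \<comment> \<open>Since \<open>L k 1 < 1 / n\<close>, the number
        \<open>L k 1 + (i - 1) / n\<close> is below 1; a nonnegative number congruent to it cannot
        be smaller.\<close>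
      have "real (i - 1) / real n \<le> L k i" if i: "i \<in> {1..n}" for i
      proof -
        obtain j where j: "i = Suc j" "Suc j \<le> n" using i by (cases i) auto
        obtain z' where z': "L k (Suc j) - L k 1 - real j / real n = of_int z'"
          using int [OF j(2)] by (elim Ints_cases)
        have "L k 1 + real j / real n < 1 / real n + real j / real n"
          using le [OF k one] \<delta> unfolding l_def by simp
        also have "\<dots> = real (Suc j) / real n" by (simp add: add_divide_distrib)
        also have "\<dots> \<le> 1" using j(2) n_pos by simp
        finally have "- 1 < real_of_int z'" using z' L(1) [OF k i] j(1) by simp
        then have "0 \<le> z'" by linarith
        then have "0 \<le> real_of_int z'" by simp
        then show ?thesis using z' L(1) [OF k one] j(1) by simp
      qed
      then have "(\<Sum>i\<in>{1..n}. real (i - 1) / real n) \<le> (\<Sum>i\<in>{1..n}. L k i)" by (rule sum_mono)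
      then have "(real n - 1) / 2 \<le> 1"
        unfolding L(2) [OF k] sum_divide_distrib [symmetric] sum_lin using n_pos by simp
      then show False using n by simp
    qed
    ultimately show ?thesis using z n_pos by simp
  qed
  have "flow l 1 = (\<Sum>k<m. flow (L k) 1)"
    unfolding flow two using L(4) one two(1) by (simp add: sum_subtractf)
  also have "\<dots> = 0" using flow_0 by simp
  finally show False using flow_l [OF one] n by simp
qed

section \<open>Level sets of the weights\<close>

definition top_weight :: nat where
  "top_weight = Max (weight ` {1..n})"

definition level :: "nat \<Rightarrow> nat set" where
  "level k = {i \<in> {1..n}. weight i = k}"

lemma weight_le_top: "i \<in> {1..n} \<Longrightarrow> weight i \<le> top_weight"
  unfolding top_weight_def by (rule Max_ge) auto

lemma finite_level [simp]: "finite (level k)"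
  by (simp add: level_def)

lemma level_top_pos: "0 < card (level top_weight)"
proof -
  have "{1..n} \<noteq> {}" using n_ge_3 by simp
  then have "top_weight \<in> weight ` {1..n}" unfolding top_weight_def by (intro Max_in) auto
  then show ?thesis unfolding card_gt_0_iff level_def by auto
qed

text \<open>By \<open>weight_rec\<close> the successor map embeds each level into the one below it;
  the chain stops at weight 1.\<close>

lemma card_level_Suc:
  assumes "S \<noteq> {1..n}" "0 < k"
  shows "card (level (Suc k)) \<le> card (level k)"
proof (rule card_inj_on_le)
  show "inj_on \<sigma> (level (Suc k))"
    by (rule inj_on_subset [OF inj_on_next_vertex]) (auto simp: level_def)
  show "\<sigma> ` level (Suc k) \<subseteq> level k"
  proof clarify
    fix i assume "i \<in> level (Suc k)"
    then have "weight (\<sigma> i) = k"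
      using weight_rec [OF assms(1), of i] assms(2) by (simp add: level_def split: if_splits)
    then show "\<sigma> i \<in> level k" using next_vertex_in by (simp add: level_def)
  qed
qed simp

lemma card_level_ge_top:
  assumes "S \<noteq> {1..n}" "0 < k" "k \<le> top_weight"
  shows "card (level top_weight) \<le> card (level k)"
  using assms(3)
proof (induction k rule: inc_induct)
  case (step k')
  then show ?case using card_level_Suc [OF assms(1), of k'] assms(2) by fastforce
qed simp

lemma sum_by_level:
  "(\<Sum>i\<in>{1..n}. f (weight i)) = (\<Sum>k\<in>{1..top_weight}. card (level k) * f k)" for f :: "nat \<Rightarrow> nat"
proof -
  have "(\<Sum>i\<in>{1..n}. f (weight i)) =
      (\<Sum>k\<in>{1..top_weight}. \<Sum>i\<in>{i \<in> {1..n}. weight i = k}. f (weight i))"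
    by (rule sum.group [symmetric]) (use weight_le_top weight_pos in \<open>auto simp: Suc_le_eq\<close>)
  also have "\<dots> = (\<Sum>k\<in>{1..top_weight}. card (level k) * f k)"
    unfolding level_def by (rule sum.cong) auto
  finally show ?thesis .
qed

text \<open>
  In a decomposition of the point with coefficients \<open>w i / M\<close> reduced modulo 1, every summand vanishes
  at the vertices of weight \<open>M\<close>, so its coefficient at a vertex of weight 1 is \<open>0\<close> or \<open>1 / M\<close>; the value
  \<open>0\<close> would make the summand integral and hence zero.
\<close>

lemma total_eq_top_weight:
  assumes refl: "reflexive_polytope n (sum_zero_hyperplane n) P"
    and idp: "integer_decomposition_property \<Lambda> P"
    and proper: "S \<noteq> {1..n}" and "S \<noteq> {}"
  shows "2 \<le> top_weight" "total = top_weight * (card (level top_weight) + 1)"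
proof -
  let ?M = "top_weight" and ?\<mu> = "card (level top_weight)"
  obtain p where p: "p \<in> {1..n}" "\<sigma> p \<notin> S" "weight p = 1" using ex_weight_1 [OF proper] .
  show M: "2 \<le> ?M"
  proof -
    obtain j where "j \<in> S" using \<open>S \<noteq> {}\<close> by blast
    then obtain i where i: "i \<in> {1..n}" "\<sigma> i \<in> S" using S_subset by (metis prev_vertexE subsetD)
    then have "2 \<le> weight i" using weight_rec [OF proper, of i] weight_pos [of "\<sigma> i"] by simp
    then show ?thesis using weight_le_top [OF i(1)] by simp
  qed
  obtain a where a: "a \<in> {1..n}" "weight a = ?M"
    using level_top_pos unfolding card_gt_0_iff level_def by auto
  obtain q where q: "total = ?M * q" using reflexive_weight_dvd [OF refl a(1)] unfolding a(2) ..
  \<comment> \<open>Minus the sum of the rows of top weight, with \<open>1 / top_weight\<close>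
    times the relation added to bring all coefficients into the unit interval.\<close>
  define l where "l = (\<lambda>i. (1 / real ?M) * real (weight i) - of_bool (weight i = ?M))"
  have l_top: "l i = 0" if "weight i = ?M" for i using that M by (simp add: l_def)
  have l_low: "l i = real (weight i) / real ?M" if "weight i \<noteq> ?M" for i
    using that by (simp add: l_def)
  have nonneg: "0 \<le> l i" for i by (cases "weight i = ?M") (simp_all add: l_top l_low)
  have less: "l i < 1" if "i \<in> {1..n}" for i
    using weight_le_top [OF that] M by (cases "weight i = ?M") (simp_all add: l_top l_low)
  have l_p: "l p = 1 / real ?M" using l_low [of p] p(3) M by simp
  have "comb l = 0 - comb (\<lambda>i. of_bool (weight i = ?M))"
    unfolding l_def comb_diff comb_scale comb_weight by simp
  moreover have "comb (\<lambda>i. of_bool (weight i = ?M)) \<in> \<Lambda>"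
    by (rule comb_int_in_lattice) simp
  ultimately have lat: "comb l \<in> \<Lambda>"
    using lattice_diff [OF zero_in_lattice] by simp
  have "(\<Sum>i\<in>{1..n}. of_bool (weight i = ?M)) = real ?\<mu>"
    by (simp add: level_def of_bool_def flip: sum.inter_filter)
  then have sum_l: "(\<Sum>i\<in>{1..n}. l i) = real q - real ?\<mu>"
    unfolding l_def sum_subtractf sum_distrib_left [symmetric] sum_weight q using M by simp
  have "0 < (\<Sum>i\<in>{1..n}. l i)"
    using sum_pos2 [of "{1..n}" p l] p(1) l_p nonneg M by simp
  then have q_gt: "?\<mu> < q" using sum_l by simp
  define m where "m = q - ?\<mu>"
  have "0 < m" "(\<Sum>i\<in>{1..n}. l i) = real m" using q_gt sum_l by (simp_all add: m_def)
  then obtain L where L: "\<And>k i. k < m \<Longrightarrow> i \<in> {1..n} \<Longrightarrow> 0 \<le> L k i"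
    "\<And>k. k < m \<Longrightarrow> (\<Sum>i\<in>{1..n}. L k i) = 1" "\<And>k. k < m \<Longrightarrow> comb (L k) \<in> \<Lambda>"
    "\<And>i. i \<in> {1..n} \<Longrightarrow> l i = (\<Sum>k<m. L k i)"
    using decomposition_coefficients [OF idp _ nonneg _ lat, of m] by blast
  have le: "L k i \<le> l i" if "k < m" "i \<in> {1..n}" for k i
    unfolding L(4) [OF that(2)] using that L(1) by (intro member_le_sum) auto
  have "L k p = 1 / real ?M" if k: "k < m" for k
  proof -
    obtain t where t: "\<And>i. i \<in> {1..n} \<Longrightarrow> L k i - t * real (weight i) \<in> \<int>"
      using lattice_coefficients [OF proper L(3) [OF k]] by blast
    \<comment> \<open>The bound by \<open>l\<close> forces this, so \<open>t\<close> is a multiple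
      of \<open>1 / top_weight\<close>.\<close>
    have "L k a = 0" using L(1) [OF k a(1)] le [OF k a(1)] l_top [OF a(2)] by simp
    then obtain z where z: "t * real ?M = of_int z"
      using t [OF a(1)] a(2) by (auto elim!: Ints_cases simp: minus_equation_iff)
    obtain b where b: "L k p = t + of_int b"
      using t [OF p(1)] p(3) by (auto elim!: Ints_cases simp: algebra_simps)
    have eq: "L k p * real ?M = of_int (z + b * int ?M)"
      using z b by (simp add: algebra_simps)
    moreover have "0 \<le> L k p * real ?M" "L k p * real ?M \<le> 1"
      using L(1) [OF k p(1)] le [OF k p(1)] M unfolding l_p by (simp_all add: field_simps)
    ultimately have "z + b * int ?M = 0 \<or> z + b * int ?M = 1" by linarith
    moreover have "z + b * int ?M \<noteq> 0"
    proof
      assume "z + b * int ?M = 0"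
      then have "L k p = 0" using eq M by simp
      then have t_int: "t = of_int (- b)" using b by simp
      have "L k i = 0" if i: "i \<in> {1..n}" for i
      proof -
        obtain c where "L k i - t * real (weight i) = of_int c" using t [OF i] by (elim Ints_cases)
        then have c: "L k i = of_int (c - b * int (weight i))" unfolding t_int by (simp add: algebra_simps)
        have "0 \<le> L k i" "L k i < 1" using L(1) [OF k i] le [OF k i] less [OF i] by linarith+
        then have "c - b * int (weight i) = 0" unfolding c by linarith
        then show ?thesis unfolding c by simp
      qed
      then show False using L(2) [OF k] by simp
    qed
    ultimately show ?thesis using eq M by (simp add: field_simps)
  qed
  \<comment> \<open>Each of the \<open>m\<close> summands already uses up the whole coefficient at
    \<open>p\<close>, so there is only one.\<close>
  then have "l p = (\<Sum>k<m. 1 / real ?M)" using L(4) [OF p(1)] by simp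
  then have "real m = 1" using l_p M by simp
  then have "q = ?\<mu> + 1" using q_gt by (simp add: m_def)
  with q show "total = ?M * (?\<mu> + 1)" by simp
qed

lemma integer_decomposition_cases:
  assumes refl: "reflexive_polytope n (sum_zero_hyperplane n) P"
    and idp: "integer_decomposition_property \<Lambda> P" and "S \<noteq> {}"
  shows "n = 3 \<or> n = 4 \<and> (S = {1, 3} \<or> S = {2, 4})"
proof (cases "S = {1..n}")
  case True
  then show ?thesis using full_not_integer_decomposition idp n_ge_3 by force
next
  case False
  let ?M = "top_weight"
  define \<mu> where "\<mu> = card (level top_weight)"
  have M: "2 \<le> ?M" and total: "total = ?M * (\<mu> + 1)"
    using total_eq_top_weight [OF refl idp False \<open>S \<noteq> {}\<close>] by (simp_all add: \<mu>_def)
  have \<mu>: "0 < \<mu>" using level_top_pos by (simp add: \<mu>_def)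
  have level: "\<mu> \<le> card (level k)" if "0 < k" "k \<le> ?M" for k
    using card_level_ge_top [OF False that] by (simp add: \<mu>_def)
  have total_levels: "total = (\<Sum>k\<in>{1..?M}. card (level k) * k)"
    using sum_by_level [of "\<lambda>k. k"] by (simp add: total_def)
  have n_levels: "n = (\<Sum>k\<in>{1..?M}. card (level k))"
    using sum_by_level [of "\<lambda>k. 1"] by simp
  have "(\<Sum>k\<in>{1..?M}. \<mu> * k) \<le> total"
    unfolding total_levels by (intro sum_mono mult_right_mono level) auto
  moreover have "2 * (\<Sum>k\<in>{1..?M}. \<mu> * k) = \<mu> * (?M * (?M + 1))"
    using Sum_Icc_nat [of 1 ?M] by (simp flip: sum_distrib_left)
  ultimately have "?M * (\<mu> * (?M + 1)) \<le> ?M * (2 * (\<mu> + 1))"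
    unfolding total by (simp add: algebra_simps)
  then have bound: "\<mu> * (?M + 1) \<le> 2 * (\<mu> + 1)" using M unfolding mult_le_cancel1 by simp
  have "?M = 2 \<and> \<mu> \<le> 2 \<or> ?M = 3 \<and> \<mu> = 1"
  proof -
    obtain r where r: "?M = r + 2" using M by (metis le_Suc_ex add.commute)
    have "\<mu> * (r + 1) \<le> 2" using bound unfolding r by (simp add: algebra_simps)
    moreover have "r + 1 \<le> \<mu> * (r + 1)" using mult_le_mono1 [of 1 \<mu> "r + 1"] \<mu> by simp
    ultimately have "r = 0 \<or> r = 1" by linarith
    then show ?thesis using \<open>\<mu> * (r + 1) \<le> 2\<close> \<mu> unfolding r by auto
  qed
  then show ?thesis
  proof
    \<comment> \<open>The total is 6 and no level is empty, so each of the three levels has one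
      element.\<close>
    assume *: "?M = 3 \<and> \<mu> = 1"
    have "{1..?M} = {1, 2, 3}" using * by auto
    then have "card (level 1) + 2 * card (level 2) + 3 * \<mu> = total"
      "n = card (level 1) + card (level 2) + \<mu>"
      using total_levels n_levels * by (simp_all add: \<mu>_def)
    then show ?thesis using level [of 1] level [of 2] total * by simp
  next
    assume *: "?M = 2 \<and> \<mu> \<le> 2"
    have "{1..?M} = {1, 2}" using * by auto
    then have "card (level 1) + 2 * \<mu> = total" "n = card (level 1) + \<mu>"
      using total_levels n_levels * by (simp_all add: \<mu>_def)
    \<comment> \<open>Comparing with the total \<open>2 * (\<mu> + 1)\<close> shows that level 1 has
      two elements.\<close>
    then have n: "n = 2 + \<mu>" using total * by simp
    show ?thesis
    proof (cases "n = 3")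
      case False
      then have "n = 4" "\<mu> = 2" using n * n_ge_3 by auto
      have V: "{1..n} = {1, 2, 3, 4}" using \<open>n = 4\<close> by auto
      have succ: "\<sigma> 1 = 2" "\<sigma> 2 = 3" "\<sigma> 3 = 4" "\<sigma> 4 = 1"
        unfolding next_vertex_def unfolding \<open>n = 4\<close> by simp_all
      note w = weight_rec [OF \<open>S \<noteq> {1..n}\<close>]
      have le: "weight i \<le> 2" if "i \<in> {1, 2, 3, 4}" for i
        using weight_le_top [of i] * that unfolding V by simp
      have "weight 1 + weight 2 + weight 3 + weight 4 = 6"
        using total * \<open>\<mu> = 2\<close> unfolding total_def V by simp
      \<comment> \<open>Weights of at most 2 exclude adjacent elements of \<open>S\<close>, and the
        sum 6 requires two vertices of weight 2.\<close>
      then have "(1 \<in> S \<and> 2 \<notin> S \<and> 3 \<in> S \<and> 4 \<notin> S) \<or> (1 \<notin> S \<and> 2 \<in> S \<and> 3 \<notin> S \<and> 4 \<in> S)"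
        using w [of 1] w [of 2] w [of 3] w [of 4] le [of 1] le [of 2] le [of 3] le [of 4]
        unfolding succ by (auto split: if_splits)
      then have "S = {1, 3} \<or> S = {2, 4}" using S_subset unfolding V by blast
      then show ?thesis using \<open>n = 4\<close> by blast
    qed simp
  qed
qed

end

section \<open>Isomorphisms of cycle digraphs\<close>

text \<open>Arcs are pairs of vertices here, so the vertex map determines the arc map and its
  injectivity.\<close>

lemma digraph_iso_pairI:
  assumes "wf_digraph (with_proj G)" "inj_on f (pverts G)"
    and "f ` pverts G = pverts H" "map_prod f f ` parcs G = parcs H"
  shows "digraph_iso (with_proj G) (with_proj H)"
proof -
  let ?h = "\<lparr> iso_verts = f, iso_arcs = map_prod f f, iso_head = snd, iso_tail = fst \<rparr>"
  have "parcs G \<subseteq> pverts G \<times> pverts G"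
    using assms(1) by (auto simp: wf_digraph_def)
  then have "inj_on (map_prod f f) (parcs G)"
    using inj_on_subset [OF map_prod_inj_on [OF assms(2,2)]] by blast
  then have "pre_digraph.digraph_isomorphism (with_proj G) ?h"
    using assms(1,2) by (simp add: pre_digraph.digraph_isomorphism_def)
  moreover have "with_proj H = app_iso ?h (with_proj G)"
    using assms(3,4) by (simp add: app_iso_def with_proj_def)
  ultimately show ?thesis unfolding digraph_iso_def by blast
qed

lemma digraph_iso_card:
  assumes "digraph_iso G H"
  shows "card (verts H) = card (verts G)" "card (arcs H) = card (arcs G)"
  using assms
  by (auto simp: digraph_iso_def pre_digraph.digraph_isomorphism_def card_image)

context cycle_laplacian
begin

lemma pverts_cycle: "pverts (cycle_digraph n S) = {1..n}"
  by (simp add: cycle_digraph_def)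

lemma wf_cycle: "wf_digraph (with_proj (cycle_digraph n S))"
  using next_vertex_in S_subset
  by unfold_locales (auto simp: pverts_cycle parcs_cycle simp del: One_nat_def atLeastAtMost_iff)

text \<open>Forward arcs are indexed by their tails and backward arcs by their heads; as
  \<open>3 \<le> n\<close>, no arc is of both kinds.\<close>

lemma card_parcs_cycle: "card (parcs (cycle_digraph n S)) = n + card S"
proof -
  let ?T = "{j \<in> {1..n}. \<sigma> j \<in> S}"
  have "parcs (cycle_digraph n S) = (\<lambda>i. (i, \<sigma> i)) ` {1..n} \<union> (\<lambda>j. (\<sigma> j, j)) ` ?T"
    by (auto simp: parcs_cycle simp del: One_nat_def atLeastAtMost_iff)
  moreover have "(\<lambda>i. (i, \<sigma> i)) ` {1..n} \<inter> (\<lambda>j. (\<sigma> j, j)) ` ?T = {}"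
    using next_vertex_neq(2) by fastforce
  moreover have "card ((\<lambda>i. (i, \<sigma> i)) ` {1..n}) = n"
    by (subst card_image) (auto simp: inj_on_def)
  moreover have "card ((\<lambda>j. (\<sigma> j, j)) ` ?T) = card ?T"
    by (rule card_image) (auto simp: inj_on_def)
  moreover have "card (\<sigma> ` ?T) = card ?T"
    by (rule card_image [OF inj_on_subset [OF inj_on_next_vertex]]) blast
  moreover have "\<sigma> ` ?T = S"
  proof
    show "S \<subseteq> \<sigma> ` ?T"
    proof
      fix i assume "i \<in> S"
      then obtain p where "p \<in> {1..n}" "i = \<sigma> p" using S_subset by (metis prev_vertexE subsetD)
      then show "i \<in> \<sigma> ` ?T" using \<open>i \<in> S\<close> by blast
    qed
  qed blast
  ultimately show ?thesis by (simp add: card_Un_disjoint)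
qed

lemma digraph_iso_rotate:
  "digraph_iso (with_proj (cycle_digraph n S)) (with_proj (cycle_digraph n (\<sigma> ` S)))"
proof (rule digraph_iso_pairI [OF wf_cycle])
  have rotated: "cycle_laplacian n (\<sigma> ` S)"
    using n_ge_3 next_vertex_in by unfold_locales auto
  note parcs_rotated = cycle_laplacian.parcs_cycle [OF rotated]
  show "inj_on \<sigma> (pverts (cycle_digraph n S))"
    unfolding pverts_cycle by (rule inj_on_next_vertex)
  show "\<sigma> ` pverts (cycle_digraph n S) = pverts (cycle_digraph n (\<sigma> ` S))"
    unfolding pverts_cycle cycle_laplacian.pverts_cycle [OF rotated] by (rule next_vertex_image)
  show "map_prod \<sigma> \<sigma> ` parcs (cycle_digraph n S) = parcs (cycle_digraph n (\<sigma> ` S))"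
  proof (intro equalityI subrelI)
    fix i j assume "(i, j) \<in> map_prod \<sigma> \<sigma> ` parcs (cycle_digraph n S)"
    then obtain a b where "(a, b) \<in> parcs (cycle_digraph n S)" "i = \<sigma> a" "j = \<sigma> b" by auto
    then show "(i, j) \<in> parcs (cycle_digraph n (\<sigma> ` S))"
      unfolding parcs_cycle parcs_rotated using next_vertex_in by blast
  next
    fix i j assume "(i, j) \<in> parcs (cycle_digraph n (\<sigma> ` S))"
    then have ij: "i \<in> {1..n} \<and> j = \<sigma> i \<or> i \<in> \<sigma> ` S \<and> j \<in> {1..n} \<and> i = \<sigma> j"
      unfolding parcs_rotated .
    have "\<exists>a b. (a, b) \<in> parcs (cycle_digraph n S) \<and> i = \<sigma> a \<and> j = \<sigma> b"
    proof (rule disjE [OF ij])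
      assume "i \<in> {1..n} \<and> j = \<sigma> i"
      then obtain p where "p \<in> {1..n}" "i = \<sigma> p" "j = \<sigma> i" using prev_vertexE by blast
      then show ?thesis unfolding parcs_cycle by blast
    next
      assume *: "i \<in> \<sigma> ` S \<and> j \<in> {1..n} \<and> i = \<sigma> j"
      then obtain s p where sp: "s \<in> S" "i = \<sigma> s" "p \<in> {1..n}" "j = \<sigma> p"
        by (metis imageE prev_vertexE)
      then have "s = \<sigma> p"
        using * next_vertex_eq_iff [of s "\<sigma> p"] S_subset next_vertex_in by (metis subsetD)
      then show ?thesis using sp unfolding parcs_cycle by blast
    qed
    then show "(i, j) \<in> map_prod \<sigma> \<sigma> ` parcs (cycle_digraph n S)" by force
  qed
qed

lemma digraph_iso_self:
  "digraph_iso (with_proj (cycle_digraph n S)) (with_proj (cycle_digraph n S))"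
  by (rule digraph_iso_pairI [OF wf_cycle, of id]) (auto simp: map_prod.id)

lemma digraph_iso_rotate_twice:
  "digraph_iso (with_proj (cycle_digraph n S)) (with_proj (cycle_digraph n (\<sigma> ` \<sigma> ` S)))"
proof -
  have "cycle_laplacian n (\<sigma> ` S)"
    using n_ge_3 next_vertex_in by unfold_locales auto
  from digraph_iso_trans [OF digraph_iso_rotate cycle_laplacian.digraph_iso_rotate [OF this]]
  show ?thesis .
qed

text \<open>Up to rotation, a nonempty subset of a 3-cycle is determined by its size, and at most
  two rotations are used.\<close>

lemma digraph_iso_3:
  assumes n: "n = 3" and "S \<noteq> {}"
  shows "digraph_iso (with_proj (cycle_digraph n S)) (with_proj (cycle_digraph 3 {1})) \<or>
    digraph_iso (with_proj (cycle_digraph n S)) (with_proj (cycle_digraph 3 {1, 2})) \<or>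
    digraph_iso (with_proj (cycle_digraph n S)) (with_proj (cycle_digraph 3 {1, 2, 3}))"
proof -
  have succ: "\<sigma> 1 = 2" "\<sigma> 2 = 3" "\<sigma> 3 = 1"
    unfolding next_vertex_def unfolding n by simp_all
  have "S \<in> Pow {1, 2, 3}" using S_subset n by auto
  also have "Pow {1, 2, 3 :: nat} = {{}, {1}, {2}, {3}, {1, 2}, {2, 3}, {1, 3}, {1, 2, 3}}"
    by (simp add: Pow_insert insert_commute)
  finally have "S = {1} \<or> S = {2} \<or> S = {3} \<or> S = {1, 2} \<or> S = {2, 3} \<or> S = {1, 3} \<or> S = {1, 2, 3}"
    using \<open>S \<noteq> {}\<close> by (simp only: insert_iff empty_iff simp_thms)
  moreover have "\<sigma> ` \<sigma> ` S = {1}" if "S = {2}" unfolding that image_insert image_empty succ ..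
  moreover have "\<sigma> ` S = {1}" if "S = {3}" unfolding that image_insert image_empty succ ..
  moreover have "\<sigma> ` \<sigma> ` S = {1, 2}" if "S = {2, 3}" unfolding that image_insert image_empty succ ..
  moreover have "\<sigma> ` S = {1, 2}" if "S = {1, 3}"
    unfolding that image_insert image_empty succ by (rule insert_commute)
  ultimately show ?thesis
    using digraph_iso_self digraph_iso_rotate digraph_iso_rotate_twice unfolding n by metis
qed

lemma digraph_iso_4:
  assumes n: "n = 4" and "S = {1, 3} \<or> S = {2, 4}"
  shows "digraph_iso (with_proj (cycle_digraph n S)) (with_proj (cycle_digraph 4 {1, 3}))"
proof -
  have succ: "\<sigma> 2 = 3" "\<sigma> 4 = 1"
    unfolding next_vertex_def unfolding n by simp_all
  have "\<sigma> ` S = {1, 3}" if "S = {2, 4}"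
    unfolding that image_insert image_empty succ by (rule insert_commute)
  then show ?thesis
    using assms(2) digraph_iso_self digraph_iso_rotate unfolding n by metis
qed

text \<open>Two adjacent elements of \<open>S\<close> would give the weights 3, 2, 1, 1 with sum 7,
  which is not divisible by 3.\<close>

lemma card_2_reflexive_4:
  assumes refl: "reflexive_polytope n (sum_zero_hyperplane n) P"
    and n: "n = 4" and card: "card S = 2"
  shows "S = {1, 3} \<or> S = {2, 4}"
proof -
  have V: "{1..n} = {1, 2, 3, 4}" using n by auto
  have succ: "\<sigma> 1 = 2" "\<sigma> 2 = 3" "\<sigma> 3 = 4" "\<sigma> 4 = 1"
    unfolding next_vertex_def unfolding n by simp_all
  have "S \<noteq> {1..n}" using card n by auto
  note w = weight_rec [OF this]
  have not_adjacent: "S \<noteq> {b, c}"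
    if abcd: "{1..n} = {a, b, c, d}" "distinct [a, b, c, d]"
      and next_eqs: "\<sigma> a = b" "\<sigma> b = c" "\<sigma> c = d" "\<sigma> d = a" for a b c d
  proof
    assume "S = {b, c}"
    then have S: "a \<notin> S" "b \<in> S" "c \<in> S" "d \<notin> S" using abcd(2) by auto
    have "weight c = 1" "weight d = 1" using S w [of c] w [of d] unfolding next_eqs by simp_all
    moreover from this have "weight b = 2" using S w [of b] unfolding next_eqs by simp
    moreover from this have "weight a = 3" using S w [of a] unfolding next_eqs by simp
    ultimately have "weight a = 3" "total = 7" using abcd unfolding total_def by simp_all
    moreover have "a \<in> {1..n}" unfolding abcd(1) by simp
    then have "weight a dvd total" by (rule reflexive_weight_dvd [OF refl])
    ultimately show False by simp
  qed
  obtain x y where xy: "S = {x, y}" "x \<noteq> y" using card by (auto simp: card_2_iff)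
  then have "x \<in> {1, 2, 3, 4}" "y \<in> {1, 2, 3, 4}" using S_subset unfolding V by auto
  moreover have "S \<noteq> {1, 2}" by (rule not_adjacent [of 4 1 2 3]) (use succ V in auto)
  moreover have "S \<noteq> {2, 3}" by (rule not_adjacent [of 1 2 3 4]) (use succ V in auto)
  moreover have "S \<noteq> {3, 4}" by (rule not_adjacent [of 2 3 4 1]) (use succ V in auto)
  moreover have "S \<noteq> {4, 1}" by (rule not_adjacent [of 3 4 1 2]) (use succ V in auto)
  ultimately show ?thesis
    unfolding xy(1) using xy(2) by (auto simp: doubleton_eq_iff)
qed

end

theorem theorem19:
  fixes n :: nat and S :: "nat set"
  assumes "3 \<le> n" and "S \<subseteq> {1..n}"
    and "reflexive_polytope n (sum_zero_hyperplane n)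
           (laplacian_polytope n (with_proj (cycle_digraph n S)))"
  shows "integer_decomposition_property (sum_zero_hyperplane n \<inter> int_points n)
           (laplacian_polytope n (with_proj (cycle_digraph n S))) \<longleftrightarrow>
         S = {} \<or>
         (digraph_iso (with_proj (cycle_digraph n S)) (with_proj (cycle_digraph 3 {1})) \<or>
          digraph_iso (with_proj (cycle_digraph n S)) (with_proj (cycle_digraph 3 {1, 2})) \<or>
          digraph_iso (with_proj (cycle_digraph n S)) (with_proj (cycle_digraph 3 {1, 2, 3})) \<or>
          digraph_iso (with_proj (cycle_digraph n S)) (with_proj (cycle_digraph 4 {1, 3})))"
    (is "?idp \<longleftrightarrow> S = {} \<or> ?iso")
proof -
  interpret cycle_laplacian n S using assms(1,2) by unfold_locales
  have n_eq: "n = k" if "digraph_iso (with_proj (cycle_digraph n S)) (with_proj (cycle_digraph k T))" for k T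
    using digraph_iso_card(1) [OF that] by (simp add: cycle_digraph_def)
  show ?thesis
  proof
    assume idp: ?idp
    show "S = {} \<or> ?iso"
      using integer_decomposition_cases [OF assms(3) idp] digraph_iso_3 digraph_iso_4 by blast
  next
    assume "S = {} \<or> ?iso"
    \<comment> \<open>From the digraphs on three vertices only \<open>n = 3\<close> is retained:
      reflexivity then suffices for the decomposition property.\<close>
    then consider "S = {}" | "n = 3"
      | "digraph_iso (with_proj (cycle_digraph n S)) (with_proj (cycle_digraph 4 {1, 3}))"
      using n_eq by blast
    then show ?idp
    proof cases
      case 1
      then show ?thesis by (rule integer_decomposition_empty)
    next
      case 2
      then show ?thesis by (rule integer_decomposition_3 [OF assms(3)])
    next
      case 3
      then have n: "n = 4" by (rule n_eq)
      interpret C: cycle_laplacian 4 "{1, 3}" by unfold_locales auto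
      \<comment> \<open>The number of arcs is invariant under isomorphism; reflexivity then recovers
        \<open>S\<close> from its size.\<close>
      have "card S = 2"
        using digraph_iso_card(2) [OF 3] C.card_parcs_cycle card_parcs_cycle n by simp
      then show ?thesis
        using integer_decomposition_4 [OF n] card_2_reflexive_4 [OF assms(3) n] by blast
    qed
  qed
qed

end
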